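(* Let $\mathcal A$ be an abelian category of finite length and let $X\in\mathcal A$ have nonisomorphic simple factors $\{S^i:i\in I\}$, with associated partial order $\preceq$ on $I$ (as defined in the context). Then for each s-set $J\subseteq I$ there exists a unique subobject $S\subset X$ such that the simple factors in any composition series for $S$ are isomorphic to $S^i$ for $i\in J$. This defines a one-to-one correspondence between subobjects $S\subset X$ and s-sets $J\subseteq I$.
   Context: An abelian category is of finite length if it is artinian and noetherian (all descending and all ascending chains of subobjects of any object stabilize). A composition series for $X$ is a filtration by subobjects $0=A_0\subset A_1\subset\cdots\subset A_n=X$ whose factors $S_k=A_k/A_{k-1}$ are all simple; by the Jordan--H\"older theorem the $S_k$ are independent of choices up to isomorphism and permutation. $X$ has nonisomorphic simple factors if $S_k\not\cong S_l$ for $1\le k<l\le n$. In that case let $I$ be an indexing set with $|I|=n$ and write $\{S_1,\ldots,S_n\}=\{S^i:i\in I\}$. For every composition series $0=B_0\subset B_1\subset\cdots\subset B_n=X$ with $T_k=B_k/B_{k-1}$ there is a unique bijection $\phi:I\to\{1,\ldots,n\}$ with $S^i\cong T_{\phi(i)}$ for all $i\in I$. The partial order $\preceq$ on $I$ is defined by: $i\preceq j$ if and only if $\phi(i)\le\phi(j)$ for all bijections $\phi$ arising in this way from composition series of $X$. A subset $J\subseteq I$ is an s-set if $i\in I$, $j\in J$ and $i\preceq j$ imply $i\in J$. "The simple factors are isomorphic to $S^i$ for $i\in J$" means that, up to isomorphism and order, the list of simple factors is $(S^i)_{i\in J}$, each occurring once. *)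

theory Defs
  imports "HOL-Algebra.Group"
begin

text \<open>Objects are the elements of \<open>Obj C\<close> and arrows those of \<open>Arr C\<close>.
  \<open>Comp C g f\<close> is \<open>g\<close> after \<open>f\<close>; it is meaningful only when \<open>Cod C f = Dom C g\<close>.
  \<open>Add C\<close> is meaningful only on parallel arrows, and \<open>Zero C A B\<close> is the zero arrow
  from \<open>A\<close> to \<open>B\<close>.\<close>

record ('o, 'm) add_cat =
  Obj :: "'o set"
  Arr :: "'m set"
  Dom :: "'m \<Rightarrow> 'o"
  Cod :: "'m \<Rightarrow> 'o"
  Id :: "'o \<Rightarrow> 'm"
  Comp :: "'m \<Rightarrow> 'm \<Rightarrow> 'm"
  Add :: "'m \<Rightarrow> 'm \<Rightarrow> 'm"
  Zero :: "'o \<Rightarrow> 'o \<Rightarrow> 'm"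

definition Hom :: "('o, 'm) add_cat \<Rightarrow> 'o \<Rightarrow> 'o \<Rightarrow> 'm set" where
  "Hom C A B = {f \<in> Arr C. Dom C f = A \<and> Cod C f = B}"

definition Hom_group :: "('o, 'm) add_cat \<Rightarrow> 'o \<Rightarrow> 'o \<Rightarrow> 'm monoid" where
  "Hom_group C A B = \<lparr>carrier = Hom C A B, monoid.mult = Add C, one = Zero C A B\<rparr>"

locale category =
  fixes C :: "('o, 'm) add_cat"
  assumes Dom_Obj: "f \<in> Arr C \<Longrightarrow> Dom C f \<in> Obj C"
    and Cod_Obj: "f \<in> Arr C \<Longrightarrow> Cod C f \<in> Obj C"
    and Id_Hom: "A \<in> Obj C \<Longrightarrow> Id C A \<in> Hom C A A"
    and Comp_Hom: "f \<in> Hom C A B \<Longrightarrow> g \<in> Hom C B D \<Longrightarrow> Comp C g f \<in> Hom C A D"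
    and Comp_Id_right: "f \<in> Hom C A B \<Longrightarrow> Comp C f (Id C A) = f"
    and Comp_Id_left: "f \<in> Hom C A B \<Longrightarrow> Comp C (Id C B) f = f"
    and Comp_assoc: "f \<in> Hom C A B \<Longrightarrow> g \<in> Hom C B D \<Longrightarrow> h \<in> Hom C D E
      \<Longrightarrow> Comp C h (Comp C g f) = Comp C (Comp C h g) f"

definition monic :: "('o, 'm) add_cat \<Rightarrow> 'm \<Rightarrow> bool" where
  "monic C m \<longleftrightarrow> m \<in> Arr C \<and>
    (\<forall>A\<in>Obj C. \<forall>f\<in>Hom C A (Dom C m). \<forall>g\<in>Hom C A (Dom C m).
      Comp C m f = Comp C m g \<longrightarrow> f = g)"

definition epic :: "('o, 'm) add_cat \<Rightarrow> 'm \<Rightarrow> bool" where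
  "epic C e \<longleftrightarrow> e \<in> Arr C \<and>
    (\<forall>A\<in>Obj C. \<forall>f\<in>Hom C (Cod C e) A. \<forall>g\<in>Hom C (Cod C e) A.
      Comp C f e = Comp C g e \<longrightarrow> f = g)"

definition iso_arrow :: "('o, 'm) add_cat \<Rightarrow> 'm \<Rightarrow> bool" where
  "iso_arrow C f \<longleftrightarrow> f \<in> Arr C \<and>
    (\<exists>g\<in>Hom C (Cod C f) (Dom C f).
      Comp C g f = Id C (Dom C f) \<and> Comp C f g = Id C (Cod C f))"

definition isomorphic :: "('o, 'm) add_cat \<Rightarrow> 'o \<Rightarrow> 'o \<Rightarrow> bool" where
  "isomorphic C A B \<longleftrightarrow> (\<exists>f\<in>Hom C A B. iso_arrow C f)"

definition zero_object :: "('o, 'm) add_cat \<Rightarrow> 'o \<Rightarrow> bool" where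
  "zero_object C Z \<longleftrightarrow> Z \<in> Obj C \<and>
    (\<forall>A\<in>Obj C. (\<exists>!f. f \<in> Hom C A Z) \<and> (\<exists>!f. f \<in> Hom C Z A))"

definition is_kernel :: "('o, 'm) add_cat \<Rightarrow> 'm \<Rightarrow> 'm \<Rightarrow> bool" where
  "is_kernel C f k \<longleftrightarrow> f \<in> Arr C \<and> k \<in> Arr C \<and> Cod C k = Dom C f \<and>
    Comp C f k = Zero C (Dom C k) (Cod C f) \<and>
    (\<forall>A\<in>Obj C. \<forall>g\<in>Hom C A (Dom C f). Comp C f g = Zero C A (Cod C f)
      \<longrightarrow> (\<exists>!u. u \<in> Hom C A (Dom C k) \<and> Comp C k u = g))"

definition is_cokernel :: "('o, 'm) add_cat \<Rightarrow> 'm \<Rightarrow> 'm \<Rightarrow> bool" where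
  "is_cokernel C f q \<longleftrightarrow> f \<in> Arr C \<and> q \<in> Arr C \<and> Dom C q = Cod C f \<and>
    Comp C q f = Zero C (Dom C f) (Cod C q) \<and>
    (\<forall>A\<in>Obj C. \<forall>g\<in>Hom C (Cod C f) A. Comp C g f = Zero C (Dom C f) A
      \<longrightarrow> (\<exists>!u. u \<in> Hom C (Cod C q) A \<and> Comp C u q = g))"

definition is_direct_sum ::
  "('o, 'm) add_cat \<Rightarrow> 'o \<Rightarrow> 'o \<Rightarrow> 'o \<Rightarrow> 'm \<Rightarrow> 'm \<Rightarrow> 'm \<Rightarrow> 'm \<Rightarrow> bool" where
  "is_direct_sum C A B P i1 i2 p1 p2 \<longleftrightarrow>
    i1 \<in> Hom C A P \<and> i2 \<in> Hom C B P \<and> p1 \<in> Hom C P A \<and> p2 \<in> Hom C P B \<and>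
    Comp C p1 i1 = Id C A \<and> Comp C p2 i2 = Id C B \<and>
    Comp C p2 i1 = Zero C A B \<and> Comp C p1 i2 = Zero C B A \<and>
    Add C (Comp C i1 p1) (Comp C i2 p2) = Id C P"

locale abelian_category = category C for C :: "('o, 'm) add_cat" +
  assumes Hom_comm_group: "A \<in> Obj C \<Longrightarrow> B \<in> Obj C \<Longrightarrow> comm_group (Hom_group C A B)"
    and Comp_Add_right: "f \<in> Hom C A B \<Longrightarrow> f' \<in> Hom C A B \<Longrightarrow> g \<in> Hom C B D
      \<Longrightarrow> Comp C g (Add C f f') = Add C (Comp C g f) (Comp C g f')"
    and Comp_Add_left: "f \<in> Hom C A B \<Longrightarrow> g \<in> Hom C B D \<Longrightarrow> g' \<in> Hom C B D
      \<Longrightarrow> Comp C (Add C g g') f = Add C (Comp C g f) (Comp C g' f)"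
    and ex_zero_object: "\<exists>Z. zero_object C Z"
    and ex_direct_sum: "A \<in> Obj C \<Longrightarrow> B \<in> Obj C
      \<Longrightarrow> \<exists>P\<in>Obj C. \<exists>i1 i2 p1 p2. is_direct_sum C A B P i1 i2 p1 p2"
    and ex_kernel: "f \<in> Arr C \<Longrightarrow> \<exists>k. is_kernel C f k"
    and ex_cokernel: "f \<in> Arr C \<Longrightarrow> \<exists>q. is_cokernel C f q"
    and monic_is_kernel: "monic C m \<Longrightarrow> \<exists>f. is_kernel C f m"
    and epic_is_cokernel: "epic C e \<Longrightarrow> \<exists>f. is_cokernel C f e"

definition monics_into :: "('o, 'm) add_cat \<Rightarrow> 'o \<Rightarrow> 'm set" where
  "monics_into C X = {m. monic C m \<and> Cod C m = X}"

definition sub_equiv :: "('o, 'm) add_cat \<Rightarrow> 'o \<Rightarrow> 'm rel" where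
  "sub_equiv C X = {(m, m'). m \<in> monics_into C X \<and> m' \<in> monics_into C X \<and>
    (\<exists>h\<in>Hom C (Dom C m) (Dom C m'). iso_arrow C h \<and> m = Comp C m' h)}"

text \<open>A subobject of \<open>X\<close> is a class of monics into \<open>X\<close>; its underlying object is
  the domain of any representative, determined up to isomorphism.\<close>

definition subobjects :: "('o, 'm) add_cat \<Rightarrow> 'o \<Rightarrow> 'm set set" where
  "subobjects C X = monics_into C X // sub_equiv C X"

definition sub_le :: "('o, 'm) add_cat \<Rightarrow> 'm set \<Rightarrow> 'm set \<Rightarrow> bool" where
  "sub_le C S T \<longleftrightarrow>
    (\<exists>m\<in>S. \<exists>m'\<in>T. \<exists>h\<in>Hom C (Dom C m) (Dom C m'). m = Comp C m' h)"

definition whole_sub :: "('o, 'm) add_cat \<Rightarrow> 'o \<Rightarrow> 'm set" where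
  "whole_sub C X = sub_equiv C X `` {Id C X}"

text \<open>All monics into \<open>X\<close> with zero domain are equivalent, so they form one class.\<close>

definition zero_sub :: "('o, 'm) add_cat \<Rightarrow> 'o \<Rightarrow> 'm set" where
  "zero_sub C X = {m \<in> monics_into C X. zero_object C (Dom C m)}"

definition simple_object :: "('o, 'm) add_cat \<Rightarrow> 'o \<Rightarrow> bool" where
  "simple_object C X \<longleftrightarrow> X \<in> Obj C \<and> \<not> zero_object C X \<and>
    (\<forall>S\<in>subobjects C X. S = zero_sub C X \<or> S = whole_sub C X)"

definition is_quotient :: "('o, 'm) add_cat \<Rightarrow> 'm set \<Rightarrow> 'm set \<Rightarrow> 'o \<Rightarrow> bool" where
  "is_quotient C T S Q \<longleftrightarrow>
    (\<exists>m\<in>S. \<exists>m'\<in>T. \<exists>h\<in>Hom C (Dom C m) (Dom C m'). m = Comp C m' h \<and>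
      (\<exists>q. is_cokernel C h q \<and> Cod C q = Q))"

text \<open>The quotient \<open>T / S\<close> of subobjects \<open>S \<subseteq> T\<close> is defined up to isomorphism only;
  one such object is chosen.\<close>

definition quotient_obj :: "('o, 'm) add_cat \<Rightarrow> 'm set \<Rightarrow> 'm set \<Rightarrow> 'o" where
  "quotient_obj C T S = (SOME Q. is_quotient C T S Q)"

locale finite_length_abelian_category = abelian_category C for C :: "('o, 'm) add_cat" +
  assumes artinian: "X \<in> Obj C \<Longrightarrow> (\<And>n. A n \<in> subobjects C X)
      \<Longrightarrow> (\<And>n. sub_le C (A (Suc n)) (A n)) \<Longrightarrow> \<exists>N. \<forall>n\<ge>N. A n = A N"
    and noetherian: "X \<in> Obj C \<Longrightarrow> (\<And>n. A n \<in> subobjects C X)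
      \<Longrightarrow> (\<And>n. sub_le C (A n) (A (Suc n))) \<Longrightarrow> \<exists>N. \<forall>n\<ge>N. A n = A N"

definition factor :: "('o, 'm) add_cat \<Rightarrow> (nat \<Rightarrow> 'm set) \<Rightarrow> nat \<Rightarrow> 'o" where
  "factor C A k = quotient_obj C (A k) (A (k - 1))"

text \<open>Only the values \<open>A 0, \<dots>, A n\<close> matter.\<close>

definition composition_series ::
  "('o, 'm) add_cat \<Rightarrow> 'o \<Rightarrow> nat \<Rightarrow> (nat \<Rightarrow> 'm set) \<Rightarrow> bool" where
  "composition_series C X n A \<longleftrightarrow> X \<in> Obj C \<and>
    (\<forall>k\<le>n. A k \<in> subobjects C X) \<and> A 0 = zero_sub C X \<and> A n = whole_sub C X \<and>
    (\<forall>k\<in>{1..n}. sub_le C (A (k - 1)) (A k) \<and> simple_object C (factor C A k))"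

definition factor_labelling :: "('o, 'm) add_cat \<Rightarrow> 'i set \<Rightarrow> ('i \<Rightarrow> 'o) \<Rightarrow> nat
    \<Rightarrow> (nat \<Rightarrow> 'm set) \<Rightarrow> ('i \<Rightarrow> nat) \<Rightarrow> bool" where
  "factor_labelling C I F n A \<phi> \<longleftrightarrow> bij_betw \<phi> I {1..n} \<and>
    (\<forall>i\<in>I. isomorphic C (F i) (factor C A (\<phi> i)))"

definition nonisomorphic_simple_factors ::
  "('o, 'm) add_cat \<Rightarrow> 'o \<Rightarrow> 'i set \<Rightarrow> ('i \<Rightarrow> 'o) \<Rightarrow> bool" where
  "nonisomorphic_simple_factors C X I F \<longleftrightarrow>
    (\<exists>n A. composition_series C X n A \<and>
      (\<forall>k l. 1 \<le> k \<and> k < l \<and> l \<le> n \<longrightarrow> \<not> isomorphic C (factor C A k) (factor C A l)) \<and>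
      (\<exists>\<phi>. factor_labelling C I F n A \<phi>))"

definition factor_le ::
  "('o, 'm) add_cat \<Rightarrow> 'o \<Rightarrow> 'i set \<Rightarrow> ('i \<Rightarrow> 'o) \<Rightarrow> 'i \<Rightarrow> 'i \<Rightarrow> bool" where
  "factor_le C X I F i j \<longleftrightarrow> i \<in> I \<and> j \<in> I \<and>
    (\<forall>n B \<phi>. composition_series C X n B \<and> factor_labelling C I F n B \<phi> \<longrightarrow> \<phi> i \<le> \<phi> j)"

definition s_set ::
  "('o, 'm) add_cat \<Rightarrow> 'o \<Rightarrow> 'i set \<Rightarrow> ('i \<Rightarrow> 'o) \<Rightarrow> 'i set \<Rightarrow> bool" where
  "s_set C X I F J \<longleftrightarrow> J \<subseteq> I \<and>
    (\<forall>i\<in>I. \<forall>j\<in>J. factor_le C X I F i j \<longrightarrow> i \<in> J)"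

text \<open>In every composition series of (the underlying object of) the subobject \<open>S\<close>, the list
  of factors is \<open>F i\<close> for \<open>i \<in> J\<close>, each once, up to isomorphism and order.\<close>

definition sub_has_factors ::
  "('o, 'm) add_cat \<Rightarrow> 'm set \<Rightarrow> ('i \<Rightarrow> 'o) \<Rightarrow> 'i set \<Rightarrow> bool" where
  "sub_has_factors C S F J \<longleftrightarrow>
    (\<forall>m\<in>S. \<forall>n A. composition_series C (Dom C m) n A
      \<longrightarrow> (\<exists>\<phi>. factor_labelling C J F n A \<phi>))"

end

theory Submission
  imports Defs "HOL-Library.Multiset"
begin

text \<open>Sending a subobject \<open>S\<close> of \<open>X\<close> to the set of simple factors of \<open>S\<close> is inverse to the
  correspondence of the theorem. Three facts about this map carry the proof.

  First, it turns meets and joins of subobjects into intersections and unions. Counting factors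
  with multiplicity, \<open>Jordan_Hoelder\<close> gives every subobject a well-defined multiset of factors
  (\<open>content\<close>). Passing from \<open>S\<close> to a \<open>T\<close> with simple \<open>T/S\<close>, the second isomorphism theorem
  shows that exactly one of the join and the meet with a fixed subobject grows, and by the same
  factor (\<open>content_meet_join\<close>). As no factor of \<open>X\<close> occurs twice, these multisets are sets
  (\<open>labels\<close>), and the claim follows. Moreover the map is injective: if \<open>S\<close> and \<open>T\<close> have the
  same factors, then so has their meet, and a subobject of \<open>S\<close> with as many factors as \<open>S\<close>
  is \<open>S\<close> itself.

  Secondly, the order on \<open>I\<close> can be read off from the sets of factors: \<open>i\<close> is below \<open>j\<close> if
  and only if every subobject that has the factor \<open>j\<close> also has the factor \<open>i\<close>
  (\<open>factor_le_iff\<close>). For a composition series \<open>B\<close> with bijection \<open>\<phi>\<close>, the subobject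
  \<open>B k\<close> has the factor \<open>i\<close> exactly when \<open>\<phi> i \<le> k\<close>, and every subobject occurs as some
  \<open>B k\<close>. Hence every set of factors is an s-set.

  Thirdly, a finite family of sets closed under unions and intersections contains every set that is
  downward closed for the preorder it induces in this way: the least member that contains \<open>j\<close> is
  the intersection of all of them, and a downward closed set is the union of the least members of
  its points (\<open>ring_of_sets_contains_downsets\<close>). Hence every s-set is a set of factors.

  The lattice-theoretic part is done for an abstract lattice in which certain covers carry labels.
  The subobjects of \<open>X\<close> are an instance by the second isomorphism theorem and because nothing lies
  strictly between two subobjects with simple quotient (\<open>subobject_lattice\<close>). Composition series
  of the object underlying \<open>S\<close> are translated to chains of subobjects of \<open>X\<close> from \<open>0\<close> to \<open>S\<close>
  by composing monics.\<close>

section \<open>Finite families of sets closed under union and intersection\<close>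

text \<open>The least member of \<open>\<F>\<close> containing \<open>j\<close> is a subset of \<open>J\<close> by downward closure, so \<open>J\<close> is
  the union of these members.\<close>

lemma ring_of_sets_contains_downsets:
  assumes fin: "finite \<F>"
    and ne: "{} \<in> \<F>"
    and un: "\<And>A B. A \<in> \<F> \<Longrightarrow> B \<in> \<F> \<Longrightarrow> A \<union> B \<in> \<F>"
    and int: "\<And>A B. A \<in> \<F> \<Longrightarrow> B \<in> \<F> \<Longrightarrow> A \<inter> B \<in> \<F>"
    and finJ: "finite J" and cover: "J \<subseteq> \<Union>\<F>"
    and down: "\<And>i j. j \<in> J \<Longrightarrow> (\<And>A. A \<in> \<F> \<Longrightarrow> j \<in> A \<Longrightarrow> i \<in> A) \<Longrightarrow> i \<in> J"
  shows "J \<in> \<F>"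
proof -
  define D where "D j = \<Inter>{A \<in> \<F>. j \<in> A}" for j
  have Inter: "\<Inter>\<G> \<in> \<F>" if "finite \<G>" "\<G> \<noteq> {}" "\<G> \<subseteq> \<F>" for \<G>
    using that by (induction \<G> rule: finite_ne_induct) (auto intro: int)
  have D: "D j \<in> \<F>" if "j \<in> J" for j
    unfolding D_def using that fin cover by (intro Inter) auto
  have "(\<Union>j\<in>K. D j) \<in> \<F>" if "finite K" "K \<subseteq> J" for K
    using that by (induction K rule: finite_induct) (auto intro: un ne D)
  then have "(\<Union>j\<in>J. D j) \<in> \<F>" using finJ by blast
  moreover have "(\<Union>j\<in>J. D j) = J"
    using down by (auto simp: D_def)
  ultimately show ?thesis by simp
qed

section \<open>Jordan-Hoelder in a lattice with labelled covers\<close>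

text \<open>The intended \<open>L\<close> is the set of subobjects of an object; it is a carrier set because it varies
  with the object. There \<open>cov a b\<close> means that \<open>b/a\<close> is simple, and \<open>lab a b\<close> is the
  isomorphism class of \<open>b/a\<close>. The assumption \<open>diamond\<close> is the second isomorphism theorem
  \<open>a/c \<cong> d/b\<close> for the meet \<open>c\<close> and the join \<open>d\<close> of \<open>a\<close> and \<open>b\<close>. In finite
  length it yields the valuation identity \<open>content_meet_join\<close>.\<close>

locale labelled_lattice =
  fixes L :: "'a set" and le :: "'a \<Rightarrow> 'a \<Rightarrow> bool" (infix "\<preceq>" 50)
    and cov :: "'a \<Rightarrow> 'a \<Rightarrow> bool" and lab :: "'a \<Rightarrow> 'a \<Rightarrow> 'l"
    and bt tp :: 'a
  assumes refl: "a \<in> L \<Longrightarrow> a \<preceq> a"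
    and antisym: "a \<in> L \<Longrightarrow> b \<in> L \<Longrightarrow> a \<preceq> b \<Longrightarrow> b \<preceq> a \<Longrightarrow> a = b"
    and trans: "a \<in> L \<Longrightarrow> b \<in> L \<Longrightarrow> c \<in> L \<Longrightarrow> a \<preceq> b \<Longrightarrow> b \<preceq> c \<Longrightarrow> a \<preceq> c"
    and bt: "bt \<in> L" "a \<in> L \<Longrightarrow> bt \<preceq> a"
    and tp: "tp \<in> L" "a \<in> L \<Longrightarrow> a \<preceq> tp"
    and ex_meet: "a \<in> L \<Longrightarrow> b \<in> L \<Longrightarrow>
      \<exists>c\<in>L. c \<preceq> a \<and> c \<preceq> b \<and> (\<forall>x\<in>L. x \<preceq> a \<and> x \<preceq> b \<longrightarrow> x \<preceq> c)"
    and ex_join: "a \<in> L \<Longrightarrow> b \<in> L \<Longrightarrow>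
      \<exists>d\<in>L. a \<preceq> d \<and> b \<preceq> d \<and> (\<forall>x\<in>L. a \<preceq> x \<and> b \<preceq> x \<longrightarrow> d \<preceq> x)"
    and cov_less: "cov a b \<Longrightarrow> a \<in> L \<and> b \<in> L \<and> a \<preceq> b \<and> a \<noteq> b"
    and cov_between: "cov a b \<Longrightarrow> c \<in> L \<Longrightarrow> a \<preceq> c \<Longrightarrow> c \<preceq> b \<Longrightarrow> c = a \<or> c = b"
    and diamond: "a \<in> L \<Longrightarrow> b \<in> L \<Longrightarrow> c \<in> L \<Longrightarrow> d \<in> L
      \<Longrightarrow> c \<preceq> a \<Longrightarrow> c \<preceq> b \<Longrightarrow> (\<And>x. x \<in> L \<Longrightarrow> x \<preceq> a \<Longrightarrow> x \<preceq> b \<Longrightarrow> x \<preceq> c)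
      \<Longrightarrow> a \<preceq> d \<Longrightarrow> b \<preceq> d \<Longrightarrow> (\<And>x. x \<in> L \<Longrightarrow> a \<preceq> x \<Longrightarrow> b \<preceq> x \<Longrightarrow> d \<preceq> x)
      \<Longrightarrow> (cov c a \<longleftrightarrow> cov b d) \<and> lab c a = lab b d"
begin

definition meet (infixl "\<^bold>\<and>" 70) where
  "a \<^bold>\<and> b = (SOME c. c \<in> L \<and> c \<preceq> a \<and> c \<preceq> b \<and> (\<forall>x\<in>L. x \<preceq> a \<and> x \<preceq> b \<longrightarrow> x \<preceq> c))"

definition join (infixl "\<^bold>\<or>" 65) where
  "a \<^bold>\<or> b = (SOME d. d \<in> L \<and> a \<preceq> d \<and> b \<preceq> d \<and> (\<forall>x\<in>L. a \<preceq> x \<and> b \<preceq> x \<longrightarrow> d \<preceq> x))"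

lemma meet:
  assumes "a \<in> L" "b \<in> L"
  shows meet_L: "a \<^bold>\<and> b \<in> L" and meet_le1: "a \<^bold>\<and> b \<preceq> a" and meet_le2: "a \<^bold>\<and> b \<preceq> b"
    and meet_greatest: "\<And>x. x \<in> L \<Longrightarrow> x \<preceq> a \<Longrightarrow> x \<preceq> b \<Longrightarrow> x \<preceq> a \<^bold>\<and> b"
proof -
  have "\<exists>c. c \<in> L \<and> c \<preceq> a \<and> c \<preceq> b \<and> (\<forall>x\<in>L. x \<preceq> a \<and> x \<preceq> b \<longrightarrow> x \<preceq> c)"
    using ex_meet[OF assms] by blast
  from someI_ex[OF this, folded meet_def] show "a \<^bold>\<and> b \<in> L" "a \<^bold>\<and> b \<preceq> a" "a \<^bold>\<and> b \<preceq> b"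
    "\<And>x. x \<in> L \<Longrightarrow> x \<preceq> a \<Longrightarrow> x \<preceq> b \<Longrightarrow> x \<preceq> a \<^bold>\<and> b" by auto
qed

lemma join:
  assumes "a \<in> L" "b \<in> L"
  shows join_L: "a \<^bold>\<or> b \<in> L" and join_ge1: "a \<preceq> a \<^bold>\<or> b" and join_ge2: "b \<preceq> a \<^bold>\<or> b"
    and join_least: "\<And>x. x \<in> L \<Longrightarrow> a \<preceq> x \<Longrightarrow> b \<preceq> x \<Longrightarrow> a \<^bold>\<or> b \<preceq> x"
proof -
  have "\<exists>d. d \<in> L \<and> a \<preceq> d \<and> b \<preceq> d \<and> (\<forall>x\<in>L. a \<preceq> x \<and> b \<preceq> x \<longrightarrow> d \<preceq> x)"
    using ex_join[OF assms] by blast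
  from someI_ex[OF this, folded join_def] show "a \<^bold>\<or> b \<in> L" "a \<preceq> a \<^bold>\<or> b" "b \<preceq> a \<^bold>\<or> b"
    "\<And>x. x \<in> L \<Longrightarrow> a \<preceq> x \<Longrightarrow> b \<preceq> x \<Longrightarrow> a \<^bold>\<or> b \<preceq> x" by auto
qed

lemma meet_absorb: "a \<in> L \<Longrightarrow> b \<in> L \<Longrightarrow> a \<preceq> b \<Longrightarrow> a \<^bold>\<and> b = a"
  by (meson antisym meet_L meet_le1 meet_greatest refl)

lemma join_absorb: "a \<in> L \<Longrightarrow> b \<in> L \<Longrightarrow> a \<preceq> b \<Longrightarrow> a \<^bold>\<or> b = b"
  by (meson antisym join_L join_ge2 join_least refl)

lemma join_absorb2: "a \<in> L \<Longrightarrow> b \<in> L \<Longrightarrow> b \<preceq> a \<Longrightarrow> a \<^bold>\<or> b = a"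
  by (meson antisym join_L join_ge1 join_least refl)

lemma meet_absorb2: "a \<in> L \<Longrightarrow> b \<in> L \<Longrightarrow> b \<preceq> a \<Longrightarrow> a \<^bold>\<and> b = b"
  by (meson antisym meet_L meet_le2 meet_greatest refl)

lemma diamond_meet_join:
  assumes "a \<in> L" "b \<in> L"
  shows "cov (a \<^bold>\<and> b) a \<longleftrightarrow> cov b (a \<^bold>\<or> b)" and "lab (a \<^bold>\<and> b) a = lab b (a \<^bold>\<or> b)"
  using diamond[OF assms meet_L[OF assms] join_L[OF assms] meet_le1[OF assms] meet_le2[OF assms] _
      join_ge1[OF assms] join_ge2[OF assms]] meet_greatest[OF assms] join_least[OF assms]
  by blast+

text \<open>Apply the diamond to \<open>y\<close> and \<open>x \<^bold>\<or> b\<close>: their meet lies between \<open>x\<close> and \<open>y\<close>, so it is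
  one of the two.\<close>

lemma cov_join:
  assumes c: "cov x y" and b: "b \<in> L"
  shows "y \<^bold>\<or> b = x \<^bold>\<or> b \<or> cov (x \<^bold>\<or> b) (y \<^bold>\<or> b) \<and> lab (x \<^bold>\<or> b) (y \<^bold>\<or> b) = lab x y"
proof -
  have x: "x \<in> L" and y: "y \<in> L" and xy: "x \<preceq> y" using cov_less[OF c] by auto
  let ?z = "x \<^bold>\<or> b"
  have z: "?z \<in> L" "x \<preceq> ?z" "b \<preceq> ?z" using join[OF x b] by auto
  have yb: "y \<^bold>\<or> b \<in> L" "y \<preceq> y \<^bold>\<or> b" "b \<preceq> y \<^bold>\<or> b" using join[OF y b] by auto
  have eq: "y \<^bold>\<or> ?z = y \<^bold>\<or> b"
  proof (rule antisym)
    show "y \<^bold>\<or> ?z \<in> L" using y z join_L by auto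
    show "y \<^bold>\<or> b \<in> L" by fact
    have "?z \<preceq> y \<^bold>\<or> b" using yb trans[OF x y yb(1) xy] by (intro join_least[OF x b]) auto
    then show "y \<^bold>\<or> ?z \<preceq> y \<^bold>\<or> b" using yb by (intro join_least[OF y z(1)]) auto
    show "y \<^bold>\<or> b \<preceq> y \<^bold>\<or> ?z"
      using join[OF y z(1)] z trans[OF b z(1)] by (intro join_least[OF y b]) auto
  qed
  have "x \<preceq> y \<^bold>\<and> ?z" using meet_greatest[OF y z(1) x xy] z by auto
  then consider "y \<^bold>\<and> ?z = x" | "y \<^bold>\<and> ?z = y"
    using cov_between[OF c meet_L[OF y z(1)]] meet_le1[OF y z(1)] by blast
  then show ?thesis
  proof cases
    case 1
    then show ?thesis using diamond_meet_join[OF y z(1)] c eq by auto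
  next
    case 2
    then have "y \<preceq> ?z" using meet_le2[OF y z(1)] by simp
    then have "y \<^bold>\<or> ?z = ?z" using join_absorb[OF y z(1)] by simp
    then show ?thesis using eq by simp
  qed
qed

text \<open>Apply the diamond to \<open>y \<^bold>\<and> b\<close> and \<open>x\<close>: their join lies between \<open>x\<close> and \<open>y\<close>, so it is
  one of the two. If it is \<open>y\<close>, then \<open>y \<preceq> x \<^bold>\<or> b\<close>; thus the join with \<open>b\<close> cannot grow
  when the meet with \<open>b\<close> does.\<close>

lemma cov_meet:
  assumes c: "cov x y" and b: "b \<in> L"
  shows "y \<^bold>\<and> b = x \<^bold>\<and> b \<or>
    cov (x \<^bold>\<and> b) (y \<^bold>\<and> b) \<and> lab (x \<^bold>\<and> b) (y \<^bold>\<and> b) = lab x y \<and> y \<^bold>\<or> b = x \<^bold>\<or> b"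
proof -
  have x: "x \<in> L" and y: "y \<in> L" and xy: "x \<preceq> y" using cov_less[OF c] by auto
  let ?z = "y \<^bold>\<and> b"
  have z: "?z \<in> L" "?z \<preceq> y" "?z \<preceq> b" using meet[OF y b] by auto
  have xb: "x \<^bold>\<and> b \<in> L" "x \<^bold>\<and> b \<preceq> x" "x \<^bold>\<and> b \<preceq> b" using meet[OF x b] by auto
  have eq: "?z \<^bold>\<and> x = x \<^bold>\<and> b"
  proof (rule antisym)
    show "?z \<^bold>\<and> x \<in> L" using x z meet_L by auto
    show "x \<^bold>\<and> b \<in> L" by fact
    show "?z \<^bold>\<and> x \<preceq> x \<^bold>\<and> b"
      using meet[OF z(1) x] z trans[OF _ z(1) b] by (intro meet_greatest[OF x b]) auto
    have "x \<^bold>\<and> b \<preceq> ?z" using xb trans[OF xb(1) x y _ xy] by (intro meet_greatest[OF y b]) auto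
    then show "x \<^bold>\<and> b \<preceq> ?z \<^bold>\<and> x" using xb by (intro meet_greatest[OF z(1) x]) auto
  qed
  have "?z \<^bold>\<or> x \<preceq> y" using join_least[OF z(1) x y] z xy by auto
  then consider "?z \<^bold>\<or> x = x" | "?z \<^bold>\<or> x = y"
    using cov_between[OF c join_L[OF z(1) x]] join_ge2[OF z(1) x] by blast
  then show ?thesis
  proof cases
    case 1
    then have "?z \<preceq> x" using join_ge1[OF z(1) x] by simp
    then have "?z \<^bold>\<and> x = ?z" using meet_absorb[OF z(1) x] by simp
    then show ?thesis using eq by simp
  next
    case 2
    have xj: "x \<^bold>\<or> b \<in> L" "x \<preceq> x \<^bold>\<or> b" "b \<preceq> x \<^bold>\<or> b" using join[OF x b] by auto
    have yj: "y \<^bold>\<or> b \<in> L" "y \<preceq> y \<^bold>\<or> b" "b \<preceq> y \<^bold>\<or> b" using join[OF y b] by auto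
    have "?z \<^bold>\<or> x \<preceq> x \<^bold>\<or> b" using xj trans[OF z(1) b xj(1) z(3)]
      by (intro join_least[OF z(1) x]) auto
    then have "y \<^bold>\<or> b \<preceq> x \<^bold>\<or> b" using 2 xj by (intro join_least[OF y b]) auto
    moreover have "x \<^bold>\<or> b \<preceq> y \<^bold>\<or> b" using yj trans[OF x y yj(1) xy]
      by (intro join_least[OF x b]) auto
    ultimately have "y \<^bold>\<or> b = x \<^bold>\<or> b" using antisym xj yj by blast
    then show ?thesis using 2 diamond_meet_join[OF z(1) x] c eq by auto
  qed
qed

text \<open>The multiset collects the labels along a chain of covers. The intermediate elements are forgotten,
  as only the labels are compared.\<close>

inductive series :: "'a \<Rightarrow> 'l multiset \<Rightarrow> 'a \<Rightarrow> bool" where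
  series_refl: "a \<in> L \<Longrightarrow> series a {#} a"
| series_step: "cov a b \<Longrightarrow> series b M c \<Longrightarrow> series a (add_mset (lab a b) M) c"

lemma series_le: "series a M b \<Longrightarrow> a \<in> L \<and> b \<in> L \<and> a \<preceq> b"
  by (induction rule: series.induct) (use refl trans cov_less in blast)+

lemma series_append: "series a M b \<Longrightarrow> series b N c \<Longrightarrow> series a (M + N) c"
  by (induction rule: series.induct) (auto intro: series_step)

lemma series_empty: "series a {#} b \<Longrightarrow> a = b"
  by (erule series.cases) auto

lemma series_same:
  assumes "series a M a" shows "M = {#}"
  using assms
proof cases
  case (series_step b N)
  then have "a \<in> L" "b \<in> L" "a \<preceq> b" "a \<noteq> b" "b \<preceq> a"
    using cov_less series_le by blast+
  then show ?thesis using antisym by blast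
qed

lemma series_join: "series a M c \<Longrightarrow> b \<in> L \<Longrightarrow> \<exists>N. series (a \<^bold>\<or> b) N (c \<^bold>\<or> b)"
proof (induction rule: series.induct)
  case (series_refl a)
  then show ?case using series.series_refl join_L by blast
next
  case (series_step a y M c)
  then obtain N where N: "series (y \<^bold>\<or> b) N (c \<^bold>\<or> b)" by blast
  from cov_join[OF series_step.hyps(1) series_step.prems] show ?case
    using N series.series_step by metis
qed

lemma series_meet: "series a M c \<Longrightarrow> b \<in> L \<Longrightarrow> \<exists>N. series (a \<^bold>\<and> b) N (c \<^bold>\<and> b)"
proof (induction rule: series.induct)
  case (series_refl a)
  then show ?case using series.series_refl meet_L by blast
next
  case (series_step a y M c)
  then obtain N where N: "series (y \<^bold>\<and> b) N (c \<^bold>\<and> b)" by blast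
  from cov_meet[OF series_step.hyps(1) series_step.prems] show ?case
    using N series.series_step by metis
qed

text \<open>If the two chains start with different covers \<open>x\<close> and \<open>y\<close> of \<open>a\<close>, then \<open>a\<close> is the meet
  of \<open>x\<close> and \<open>y\<close>, and both chains can be compared with chains through the join of \<open>x\<close> and
  \<open>y\<close>: by the diamond these have the same two first labels, in opposite order.\<close>

theorem Jordan_Hoelder: "series a M c \<Longrightarrow> series a N c \<Longrightarrow> M = N"
proof (induction "size M" arbitrary: a M N)
  case 0
  then show ?case using series_empty series_same by (metis size_eq_0_iff_empty)
next
  case (Suc n)
  from \<open>series a M c\<close> Suc.hyps(2) obtain x M' where
    x: "cov a x" "series x M' c" "M = add_mset (lab a x) M'"
    by (cases rule: series.cases) auto
  have "a \<noteq> c" using Suc.prems(1) Suc.hyps(2) series_same by fastforce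
  with \<open>series a N c\<close> obtain y N' where
    y: "cov a y" "series y N' c" "N = add_mset (lab a y) N'"
    by (cases rule: series.cases) auto
  have sz: "n = size M'" using x Suc.hyps(2) by simp
  show ?case
  proof (cases "x = y")
    case True
    then show ?thesis using Suc.hyps(1)[OF sz x(2)] x y by auto
  next
    case False
    have L: "a \<in> L" "x \<in> L" "y \<in> L" "c \<in> L" and ax: "a \<preceq> x" and ay: "a \<preceq> y"
      and xc: "x \<preceq> c" and yc: "y \<preceq> c"
      using cov_less[OF x(1)] cov_less[OF y(1)] series_le[OF x(2)] series_le[OF y(2)] by auto
    have m: "x \<^bold>\<and> y = a"
    proof -
      have "a \<preceq> x \<^bold>\<and> y" using meet_greatest[OF L(2,3,1) ax ay] .
      then have "x \<^bold>\<and> y = a \<or> x \<^bold>\<and> y = x" "x \<^bold>\<and> y = a \<or> x \<^bold>\<and> y = y"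
        using cov_between[OF x(1) meet_L[OF L(2,3)]] cov_between[OF y(1) meet_L[OF L(2,3)]]
          meet_le1[OF L(2,3)] meet_le2[OF L(2,3)] by blast+
      then show ?thesis using False by auto
    qed
    have m': "y \<^bold>\<and> x = a"
      using m meet[OF L(2,3)] meet[OF L(3,2)] antisym by auto
    have j: "y \<^bold>\<or> x = x \<^bold>\<or> y"
      using join[OF L(2,3)] join[OF L(3,2)] antisym by auto
    let ?v = "x \<^bold>\<or> y"
    have v: "cov x ?v" "lab x ?v = lab a y" "cov y ?v" "lab y ?v = lab a x"
      using diamond_meet_join[OF L(2,3)] diamond_meet_join[OF L(3,2)] x y m m' j by auto
    have "?v \<^bold>\<or> x = ?v" "c \<^bold>\<or> ?v = c"
      using join_absorb2 join_L join_ge1 join_least L xc yc by auto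
    moreover have "x \<^bold>\<or> ?v = ?v" using join_absorb join_L join_ge1 L by auto
    ultimately obtain Z where Z: "series ?v Z c"
      using series_join[OF x(2) join_L[OF L(2,3)]] by auto
    \<comment> \<open>The second use of the induction hypothesis is for chains from \<open>y\<close>, whose length is
      known to be \<open>n\<close> only through the first one.\<close>
    have "series x (add_mset (lab a y) Z) c" "series y (add_mset (lab a x) Z) c"
      using series_step[OF v(1) Z] series_step[OF v(3) Z] v by auto
    moreover from this(1) have M': "M' = add_mset (lab a y) Z"
      using Suc.hyps(1)[OF sz x(2)] by blast
    ultimately have "add_mset (lab a x) Z = N'"
      using Suc.hyps(1)[OF _ _ y(2)] sz by simp
    then show ?thesis using M' x y by auto
  qed
qed

definition content :: "'a \<Rightarrow> 'l multiset" where
  "content a = (THE M. series bt M a)"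

lemma content_eq: "series bt M a \<Longrightarrow> content a = M"
  unfolding content_def using Jordan_Hoelder by blast

definition chain :: "nat \<Rightarrow> (nat \<Rightarrow> 'a) \<Rightarrow> bool" where
  "chain n A \<longleftrightarrow> (\<forall>k<n. cov (A k) (A (Suc k)))"

text \<open>Composition series are given as indexed families. This lemma and \<open>series_imp_chain\<close> translate
  between them and \<open>series\<close>.\<close>

lemma chain_series:
  assumes "A 0 \<in> L" "chain n A" "k \<le> n"
  shows "series (A 0) (image_mset (\<lambda>l. lab (A l) (A (Suc l))) (mset_set {..<k})) (A k)"
  using assms(3)
proof (induction k)
  case 0
  then show ?case using series_refl assms by simp
next
  case (Suc k)
  then have c: "cov (A k) (A (Suc k))" using assms by (simp add: chain_def)
  then have "series (A k) {#lab (A k) (A (Suc k))#} (A (Suc k))"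
    using series_step[OF c series_refl] cov_less by blast
  from series_append[OF Suc.IH this] Suc.prems show ?case
    by (simp add: lessThan_Suc)
qed

lemma series_imp_chain: "series a M b \<Longrightarrow> \<exists>n A. A 0 = a \<and> A n = b \<and> chain n A"
proof (induction rule: series.induct)
  case (series_refl a)
  show ?case by (rule exI[of _ 0], rule exI[of _ "\<lambda>_. a"]) (simp add: chain_def)
next
  case (series_step a b M c)
  then obtain n A where A: "A 0 = b" "A n = c" "chain n A" by blast
  have "chain (Suc n) (case_nat a A)"
    using A series_step.hyps(1) by (auto simp: chain_def split: nat.split)
  then show ?case using A by (intro exI[of _ "Suc n"] exI[of _ "case_nat a A"]) simp
qed

end

locale finite_length_labelled_lattice = labelled_lattice +
  assumes ex_series: "\<exists>M. series bt M tp"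
begin

text \<open>Meet a given chain from \<open>bt\<close> to \<open>tp\<close> with \<open>a\<close>.\<close>

lemma series_content: assumes "a \<in> L" shows "series bt (content a) a"
proof -
  from ex_series obtain M where "series bt M tp" ..
  from series_meet[OF this assms] obtain N where "series (bt \<^bold>\<and> a) N (tp \<^bold>\<and> a)" ..
  then have "series bt N a"
    using meet_absorb[OF bt(1) assms] meet_absorb2[OF tp(1) assms] bt tp assms by auto
  then show ?thesis using content_eq by blast
qed

lemma ex_series_le: assumes "a \<in> L" "b \<in> L" "a \<preceq> b" shows "\<exists>M. series a M b"
proof -
  from series_join[OF series_content[OF assms(2)] assms(1)] obtain N where "series (bt \<^bold>\<or> a) N (b \<^bold>\<or> a)" ..
  then show ?thesis
    using join_absorb[OF bt(1) assms(1)] join_absorb2[OF assms(2,1)] bt assms by auto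
qed

lemma content_series: "series a M b \<Longrightarrow> content b = content a + M"
  using series_append[OF series_content] content_eq series_le by blast

lemma content_mono: "a \<in> L \<Longrightarrow> b \<in> L \<Longrightarrow> a \<preceq> b \<Longrightarrow> content a \<subseteq># content b"
  using ex_series_le content_series by (metis mset_subset_eq_add_left)

lemma content_bt: "content bt = {#}"
  using content_eq series_refl bt by blast

lemma content_cov: "cov a b \<Longrightarrow> content b = add_mset (lab a b) (content a)"
  using content_series[OF series_step[OF _ series_refl]] cov_less by simp

lemma content_inj_le: "a \<in> L \<Longrightarrow> b \<in> L \<Longrightarrow> a \<preceq> b \<Longrightarrow> content a = content b \<Longrightarrow> a = b"
  using ex_series_le content_series series_empty by (metis add_cancel_right_right)

text \<open>Along a cover, the multiset on the left gains at most the label of the cover, since only one of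
  join and meet can grow.\<close>

lemma content_meet_join_series:
  "series x M y \<Longrightarrow> b \<in> L \<Longrightarrow>
    content (y \<^bold>\<or> b) + content (y \<^bold>\<and> b) \<subseteq># content (x \<^bold>\<or> b) + content (x \<^bold>\<and> b) + M"
proof (induction rule: series.induct)
  case (series_step x y M c)
  have "content (y \<^bold>\<or> b) + content (y \<^bold>\<and> b) \<subseteq>#
      add_mset (lab x y) (content (x \<^bold>\<or> b) + content (x \<^bold>\<and> b))"
  proof -
    have "content (y \<^bold>\<or> b) = content (x \<^bold>\<or> b)
        \<or> content (y \<^bold>\<or> b) = add_mset (lab x y) (content (x \<^bold>\<or> b))"
      using cov_join[OF series_step.hyps(1) series_step.prems] content_cov by metis
    moreover have "content (y \<^bold>\<and> b) = content (x \<^bold>\<and> b)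
        \<or> content (y \<^bold>\<and> b) = add_mset (lab x y) (content (x \<^bold>\<and> b))
          \<and> content (y \<^bold>\<or> b) = content (x \<^bold>\<or> b)"
      using cov_meet[OF series_step.hyps(1) series_step.prems] content_cov by metis
    ultimately show ?thesis by (elim disjE conjE) simp_all
  qed
  then have "content (y \<^bold>\<or> b) + content (y \<^bold>\<and> b) + M \<subseteq>#
      content (x \<^bold>\<or> b) + content (x \<^bold>\<and> b) + add_mset (lab x y) M"
    using subset_mset.add_right_mono[of "content (y \<^bold>\<or> b) + content (y \<^bold>\<and> b)" _ M]
    by fastforce
  with series_step.IH[OF series_step.prems] show ?case
    using subset_mset.order_trans by blast
qed auto

text \<open>Both sides agree at \<open>a = bt\<close> and at \<open>a = tp\<close>. Along a chain from \<open>bt\<close> to \<open>tp\<close> the right side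
  gains every label, and the left side gains no more than that. Going up from \<open>bt\<close> gives one
  inclusion, and coming down from \<open>tp\<close> the other.\<close>

theorem content_meet_join:
  assumes a: "a \<in> L" and b: "b \<in> L"
  shows "content (a \<^bold>\<or> b) + content (a \<^bold>\<and> b) = content a + content b"
proof (rule subset_mset.antisym)
  show "content (a \<^bold>\<or> b) + content (a \<^bold>\<and> b) \<subseteq># content a + content b"
    using content_meet_join_series[OF series_content[OF a] b] content_bt
      join_absorb[OF bt(1) b] meet_absorb[OF bt(1) b] bt b by (simp add: add.commute)
  obtain M where M: "series a M tp" using ex_series_le[OF a tp(1)] tp a by blast
  have "content tp + content b \<subseteq># content (a \<^bold>\<or> b) + content (a \<^bold>\<and> b) + M"
    using content_meet_join_series[OF M b] join_absorb2[OF tp(1) b] meet_absorb2[OF tp(1) b] tp b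
    by simp
  then show "content a + content b \<subseteq># content (a \<^bold>\<or> b) + content (a \<^bold>\<and> b)"
    unfolding content_series[OF M] by (simp add: add.commute add.left_commute)
qed

lemma ex_chain_through:
  assumes c: "c \<in> L"
  obtains n p A where "p \<le> n" "A 0 = bt" "A p = c" "A n = tp" "chain n A"
proof -
  obtain p A where A: "A 0 = bt" "A p = c" "chain p A"
    using series_imp_chain[OF series_content[OF c]] by blast
  obtain M where "series c M tp" using ex_series_le[OF c tp(1)] tp c by blast
  then obtain r B where B: "B 0 = c" "B r = tp" "chain r B" using series_imp_chain by blast
  define D where "D k = (if k \<le> p then A k else B (k - p))" for k
  have "chain (p + r) D"
    unfolding chain_def
  proof (intro allI impI)
    fix k assume k: "k < p + r"
    consider "k < p" | "k \<ge> p" by linarith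
    then show "cov (D k) (D (Suc k))"
    proof cases
      case 1
      then show ?thesis using A by (simp add: D_def chain_def)
    next
      case 2
      have "D k = B (k - p)" using 2 A B by (auto simp: D_def)
      moreover have "D (Suc k) = B (Suc (k - p))" using 2 by (simp add: D_def Suc_diff_le)
      moreover have "cov (B (k - p)) (B (Suc (k - p)))" using B k 2 by (simp add: chain_def)
      ultimately show ?thesis by simp
    qed
  qed
  moreover have "D 0 = bt" "D p = c" "D (p + r) = tp" using A B by (auto simp: D_def)
  ultimately show ?thesis using that[of p "p + r" D] by simp
qed

end

locale multiplicity_free_lattice = finite_length_labelled_lattice +
  assumes count_tp: "count (content tp) l \<le> 1"
begin

definition labels :: "'a \<Rightarrow> 'b set" where
  "labels a = set_mset (content a)"

lemma count_content: assumes "a \<in> L" shows "count (content a) l = (if l \<in> labels a then 1 else 0)"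
proof -
  have "count (content a) l \<le> 1"
    using mset_subset_eq_count[OF content_mono[OF assms tp(1) tp(2)[OF assms]]] count_tp le_trans
    by blast
  moreover have "count (content a) l = 0 \<longleftrightarrow> l \<notin> labels a"
    unfolding labels_def by (simp add: count_eq_zero_iff)
  ultimately show ?thesis by (auto simp del: count_eq_zero_iff)
qed

lemma content_labels: "a \<in> L \<Longrightarrow> content a = mset_set (labels a)"
  by (rule multiset_eqI) (simp add: count_content count_mset_set' labels_def)

lemma labels_mono: "a \<in> L \<Longrightarrow> b \<in> L \<Longrightarrow> a \<preceq> b \<Longrightarrow> labels a \<subseteq> labels b"
  using content_mono unfolding labels_def by (meson set_mset_mono)

text \<open>Compare multiplicities in \<open>content_meet_join\<close>; all of them are \<open>0\<close> or \<open>1\<close>.\<close>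

lemma labels_meet_join:
  assumes a: "a \<in> L" and b: "b \<in> L"
  shows labels_meet: "labels (a \<^bold>\<and> b) = labels a \<inter> labels b"
    and labels_join: "labels (a \<^bold>\<or> b) = labels a \<union> labels b"
proof -
  have mj: "a \<^bold>\<and> b \<in> L" "a \<^bold>\<or> b \<in> L" using assms meet_L join_L by auto
  have "labels (a \<^bold>\<and> b) \<subseteq> labels a" "labels (a \<^bold>\<and> b) \<subseteq> labels b"
    "labels a \<subseteq> labels (a \<^bold>\<or> b)" "labels b \<subseteq> labels (a \<^bold>\<or> b)"
    using labels_mono meet_le1 meet_le2 join_ge1 join_ge2 a b mj by auto
  moreover have "(l \<in> labels (a \<^bold>\<and> b) \<longleftrightarrow> l \<in> labels a \<and> l \<in> labels b) \<and>
      (l \<in> labels (a \<^bold>\<or> b) \<longleftrightarrow> l \<in> labels a \<or> l \<in> labels b)" for l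
    using arg_cong[OF content_meet_join[OF a b], of "\<lambda>M. count M l"] calculation
    by (auto simp: count_content a b mj split: if_splits)
  ultimately show "labels (a \<^bold>\<and> b) = labels a \<inter> labels b" "labels (a \<^bold>\<or> b) = labels a \<union> labels b"
    by blast+
qed

lemma labels_inj: assumes a: "a \<in> L" and b: "b \<in> L" and eq: "labels a = labels b" shows "a = b"
proof -
  have "a \<^bold>\<and> b \<in> L" using meet_L a b by blast
  then have "content (a \<^bold>\<and> b) = content a" "content (a \<^bold>\<and> b) = content b"
    using content_labels labels_meet[OF a b] eq a b by auto
  then have "a \<^bold>\<and> b = a" "a \<^bold>\<and> b = b"
    using content_inj_le meet_L meet_le1 meet_le2 a b by blast+
  then show ?thesis by simp
qed

theorem ex_labels_downset:
  assumes J: "J \<subseteq> labels tp"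
    and down: "\<And>i j. j \<in> J \<Longrightarrow> (\<And>a. a \<in> L \<Longrightarrow> j \<in> labels a \<Longrightarrow> i \<in> labels a) \<Longrightarrow> i \<in> J"
  shows "\<exists>a\<in>L. labels a = J"
proof -
  have fin: "finite (labels tp)" unfolding labels_def by simp
  have "J \<in> labels ` L"
  proof (rule ring_of_sets_contains_downsets)
    have "labels ` L \<subseteq> Pow (labels tp)" using labels_mono tp by blast
    then show "finite (labels ` L)" using fin finite_subset by blast
    show "{} \<in> labels ` L" using content_bt bt(1) unfolding labels_def by force
    show "finite J" using J fin finite_subset by blast
    show "J \<subseteq> \<Union>(labels ` L)" using J tp(1) by blast
    show "A \<union> B \<in> labels ` L" if "A \<in> labels ` L" "B \<in> labels ` L" for A B
    proof -
      from that obtain a b where "a \<in> L" "b \<in> L" "A = labels a" "B = labels b" by blast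
      then show ?thesis using labels_join[of a b] join_L[of a b] by (auto intro!: image_eqI[of _ _ "a \<^bold>\<or> b"])
    qed
    show "A \<inter> B \<in> labels ` L" if "A \<in> labels ` L" "B \<in> labels ` L" for A B
    proof -
      from that obtain a b where "a \<in> L" "b \<in> L" "A = labels a" "B = labels b" by blast
      then show ?thesis using labels_meet[of a b] meet_L[of a b] by (auto intro!: image_eqI[of _ _ "a \<^bold>\<and> b"])
    qed
    show "i \<in> J" if "j \<in> J" "\<And>A. A \<in> labels ` L \<Longrightarrow> j \<in> A \<Longrightarrow> i \<in> A" for i j
      using down[OF that(1)] that(2) by blast
  qed
  then show ?thesis by auto
qed

end

section \<open>Abelian categories: cancellation and the image factorization\<close>

context category
begin

abbreviation comp (infixr "\<cdot>" 70) where "g \<cdot> f \<equiv> Comp C g f"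

lemma HomD:
  assumes "f \<in> Hom C A B"
  shows "f \<in> Arr C" "Dom C f = A" "Cod C f = B" "A \<in> Obj C" "B \<in> Obj C"
  using assms Dom_Obj Cod_Obj by (auto simp: Hom_def)

lemma iso_arrow_iff:
  "f \<in> Hom C A B \<Longrightarrow>
    iso_arrow C f \<longleftrightarrow> (\<exists>g\<in>Hom C B A. g \<cdot> f = Id C A \<and> f \<cdot> g = Id C B)"
  unfolding iso_arrow_def using HomD(1-3) by fastforce

lemma isomorphic_iff:
  "isomorphic C A B \<longleftrightarrow>
    (\<exists>f\<in>Hom C A B. \<exists>g\<in>Hom C B A. g \<cdot> f = Id C A \<and> f \<cdot> g = Id C B)"
  unfolding isomorphic_def using iso_arrow_iff by blast

lemma isomorphic_Obj: "isomorphic C A B \<Longrightarrow> A \<in> Obj C \<and> B \<in> Obj C"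
  unfolding isomorphic_def using HomD by blast

lemma isomorphic_refl: "A \<in> Obj C \<Longrightarrow> isomorphic C A A"
  unfolding isomorphic_iff using Id_Hom Comp_Id_left by blast

lemma isomorphic_sym: "isomorphic C A B \<Longrightarrow> isomorphic C B A"
  unfolding isomorphic_iff by (elim bexE conjE) (intro bexI conjI)

lemma inverse_comp:
  assumes "f \<in> Hom C A B" "f' \<in> Hom C B A" "f' \<cdot> f = Id C A"
    and "g \<in> Hom C B D" "g' \<in> Hom C D B" "g' \<cdot> g = Id C B"
  shows "(f' \<cdot> g') \<cdot> (g \<cdot> f) = Id C A"
proof -
  have "g' \<cdot> (g \<cdot> f) = f"
    using Comp_assoc[OF assms(1,4,5)] assms(6) Comp_Id_left[OF assms(1)] by simp
  then show ?thesis
    using Comp_assoc[OF Comp_Hom[OF assms(1,4)] assms(5,2)] assms(3) by simp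
qed

lemma isomorphic_trans:
  assumes "isomorphic C A B" "isomorphic C B D"
  shows "isomorphic C A D"
proof -
  from assms obtain f f' g g' where
    f: "f \<in> Hom C A B" "f' \<in> Hom C B A" "f' \<cdot> f = Id C A" "f \<cdot> f' = Id C B"
    and g: "g \<in> Hom C B D" "g' \<in> Hom C D B" "g' \<cdot> g = Id C B" "g \<cdot> g' = Id C D"
    unfolding isomorphic_iff by blast
  show ?thesis unfolding isomorphic_iff
    using Comp_Hom[OF f(1) g(1)] Comp_Hom[OF g(2) f(2)]
      inverse_comp[OF f(1-3) g(1-3)] inverse_comp[OF g(2,1,4) f(2,1,4)] by blast
qed

definition factors_through :: "'m \<Rightarrow> 'm \<Rightarrow> bool" where
  "factors_through f m \<longleftrightarrow> (\<exists>h\<in>Hom C (Dom C f) (Dom C m). f = m \<cdot> h)"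

lemma factors_throughI:
  "h \<in> Hom C A B \<Longrightarrow> m \<in> Hom C B D \<Longrightarrow> m \<cdot> h = f \<Longrightarrow> factors_through f m"
  unfolding factors_through_def using HomD Comp_Hom by metis

lemma factors_throughE:
  assumes "factors_through f m" "f \<in> Hom C A D" "m \<in> Hom C B D"
  obtains h where "h \<in> Hom C A B" "m \<cdot> h = f"
  using assms unfolding factors_through_def by (metis HomD(2))

lemma monicD:
  "monic C m \<Longrightarrow> m \<in> Hom C A B \<Longrightarrow> f \<in> Hom C D A \<Longrightarrow> g \<in> Hom C D A \<Longrightarrow> m \<cdot> f = m \<cdot> g \<Longrightarrow> f = g"
  unfolding monic_def using HomD by metis

lemma epicD:
  "epic C e \<Longrightarrow> e \<in> Hom C A B \<Longrightarrow> f \<in> Hom C B D \<Longrightarrow> g \<in> Hom C B D \<Longrightarrow> f \<cdot> e = g \<cdot> e \<Longrightarrow> f = g"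
  unfolding epic_def using HomD by metis

lemma monic_comp:
  assumes "monic C m" "m \<in> Hom C A B" "monic C n" "n \<in> Hom C B D"
  shows "monic C (n \<cdot> m)"
proof -
  have nm: "n \<cdot> m \<in> Hom C A D" using assms Comp_Hom by blast
  have "f = g" if "f \<in> Hom C E A" "g \<in> Hom C E A" "(n \<cdot> m) \<cdot> f = (n \<cdot> m) \<cdot> g" for E f g
  proof -
    have "n \<cdot> (m \<cdot> f) = n \<cdot> (m \<cdot> g)" using that assms Comp_assoc by metis
    then have "m \<cdot> f = m \<cdot> g" using monicD[OF assms(3,4)] Comp_Hom assms(2) that by blast
    then show ?thesis using monicD[OF assms(1,2)] that by blast
  qed
  then show ?thesis unfolding monic_def using HomD[OF nm] by auto
qed

lemma iso_arrow_monic: "iso_arrow C f \<Longrightarrow> monic C f"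
proof -
  assume i: "iso_arrow C f"
  then have f: "f \<in> Hom C (Dom C f) (Cod C f)" by (simp add: iso_arrow_def Hom_def)
  from i obtain g where g: "g \<in> Hom C (Cod C f) (Dom C f)" "g \<cdot> f = Id C (Dom C f)"
    unfolding iso_arrow_def by blast
  have "u = v" if "u \<in> Hom C E (Dom C f)" "v \<in> Hom C E (Dom C f)" "f \<cdot> u = f \<cdot> v" for E u v
    using that f g Comp_assoc Comp_Id_left by metis
  then show "monic C f" unfolding monic_def using i by (auto simp: iso_arrow_def)
qed

lemma iso_arrow_epic: "iso_arrow C f \<Longrightarrow> epic C f"
proof -
  assume i: "iso_arrow C f"
  then have f: "f \<in> Hom C (Dom C f) (Cod C f)" by (simp add: iso_arrow_def Hom_def)
  from i obtain g where g: "g \<in> Hom C (Cod C f) (Dom C f)" "f \<cdot> g = Id C (Cod C f)"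
    unfolding iso_arrow_def by blast
  have "u = v" if u: "u \<in> Hom C (Cod C f) E" "v \<in> Hom C (Cod C f) E" "u \<cdot> f = v \<cdot> f" for E u v
    using Comp_assoc[OF g(1) f u(1)] Comp_assoc[OF g(1) f u(2)] u g
      Comp_Id_right[OF u(1)] Comp_Id_right[OF u(2)] by simp
  then show "epic C f" unfolding epic_def using i by (auto simp: iso_arrow_def)
qed

lemma epic_comp:
  assumes "epic C e" "e \<in> Hom C A B" "epic C d" "d \<in> Hom C B D"
  shows "epic C (d \<cdot> e)"
proof -
  have de: "d \<cdot> e \<in> Hom C A D" using assms Comp_Hom by blast
  have "f = g" if f: "f \<in> Hom C D E" "g \<in> Hom C D E" "f \<cdot> (d \<cdot> e) = g \<cdot> (d \<cdot> e)" for E f g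
  proof -
    have "(f \<cdot> d) \<cdot> e = (g \<cdot> d) \<cdot> e"
      using f(3) Comp_assoc[OF assms(2,4) f(1)] Comp_assoc[OF assms(2,4) f(2)] by simp
    then have "f \<cdot> d = g \<cdot> d"
      using epicD[OF assms(1,2)] Comp_Hom[OF assms(4)] f by blast
    then show ?thesis using epicD[OF assms(3,4)] f by blast
  qed
  then show ?thesis unfolding epic_def using HomD[OF de] by auto
qed

lemma monic_first_factor:
  assumes "monic C (n \<cdot> m)" "m \<in> Hom C A B" "n \<in> Hom C B D"
  shows "monic C m"
proof -
  have nm: "n \<cdot> m \<in> Hom C A D" using assms Comp_Hom by blast
  have "f = g" if f: "f \<in> Hom C E A" "g \<in> Hom C E A" "m \<cdot> f = m \<cdot> g" for E f g
    using Comp_assoc[OF f(1) assms(2,3)] Comp_assoc[OF f(2) assms(2,3)]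
      monicD[OF assms(1) nm f(1,2)] f(3) by simp
  then show ?thesis unfolding monic_def using HomD[OF assms(2)] by auto
qed

end

context abelian_category
begin

abbreviation zero where "zero A B \<equiv> Zero C A B"

lemma zero_Hom: "A \<in> Obj C \<Longrightarrow> B \<in> Obj C \<Longrightarrow> zero A B \<in> Hom C A B"
proof -
  assume "A \<in> Obj C" "B \<in> Obj C"
  then interpret G: comm_group "Hom_group C A B" by (rule Hom_comm_group)
  show ?thesis using G.one_closed by (simp add: Hom_group_def)
qed

lemma Add_eq_zero:
  assumes "d \<in> Hom C A B" "g \<in> Hom C A B" "Add C d g = g" shows "d = zero A B"
proof -
  interpret G: comm_group "Hom_group C A B" by (rule Hom_comm_group[OF HomD(4,5)[OF assms(1)]])
  show ?thesis using G.l_cancel_one[of g d] G.r_cancel_one[of g d] assms by (simp add: Hom_group_def)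
qed

lemma Add_zero: "A \<in> Obj C \<Longrightarrow> B \<in> Obj C \<Longrightarrow> Add C (zero A B) (zero A B) = zero A B"
proof -
  assume "A \<in> Obj C" "B \<in> Obj C"
  then interpret G: comm_group "Hom_group C A B" by (rule Hom_comm_group)
  show ?thesis using G.l_one[OF G.one_closed] by (simp add: Hom_group_def)
qed

lemma comp_zero_right:
  assumes g: "g \<in> Hom C B D" and A: "A \<in> Obj C"
  shows "g \<cdot> zero A B = zero A D"
proof (rule Add_eq_zero)
  have z: "zero A B \<in> Hom C A B" using zero_Hom HomD(4,5) g A by blast
  then show "g \<cdot> zero A B \<in> Hom C A D" "g \<cdot> zero A B \<in> Hom C A D" using Comp_Hom g by blast+
  show "Add C (g \<cdot> zero A B) (g \<cdot> zero A B) = g \<cdot> zero A B"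
    using Comp_Add_right[OF z z g] Add_zero HomD(4,5) g A by metis
qed

lemma comp_zero_left:
  assumes f: "f \<in> Hom C A B" and D: "D \<in> Obj C"
  shows "zero B D \<cdot> f = zero A D"
proof (rule Add_eq_zero)
  have z: "zero B D \<in> Hom C B D" using zero_Hom HomD(4,5) f D by blast
  then show "zero B D \<cdot> f \<in> Hom C A D" "zero B D \<cdot> f \<in> Hom C A D" using Comp_Hom f by blast+
  show "Add C (zero B D \<cdot> f) (zero B D \<cdot> f) = zero B D \<cdot> f"
    using Comp_Add_left[OF f z z] Add_zero HomD(4,5) f D by metis
qed

text \<open>Differences reduce cancellation in \<open>monic\<close> and \<open>epic\<close> to statements about zero arrows.\<close>

lemma ex_difference:
  assumes f: "f \<in> Hom C A B" and g: "g \<in> Hom C A B"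
  obtains d where "d \<in> Hom C A B" "Add C d g = f" "d = zero A B \<Longrightarrow> f = g"
proof -
  interpret G: comm_group "Hom_group C A B" by (rule Hom_comm_group[OF HomD(4,5)[OF f]])
  let ?d = "f \<otimes>\<^bsub>Hom_group C A B\<^esub> inv\<^bsub>Hom_group C A B\<^esub> g"
  have c: "f \<in> carrier (Hom_group C A B)" "g \<in> carrier (Hom_group C A B)"
    using f g by (auto simp: Hom_group_def)
  have d: "?d \<in> carrier (Hom_group C A B)" using c by simp
  moreover have "?d \<otimes>\<^bsub>Hom_group C A B\<^esub> g = f" using c by (simp add: G.m_assoc)
  moreover from this have "?d = \<one>\<^bsub>Hom_group C A B\<^esub> \<Longrightarrow> f = g" using c by simp
  ultimately show ?thesis using that[of ?d] by (simp add: Hom_group_def)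
qed

lemma monicI:
  assumes m: "m \<in> Hom C A B"
    and z: "\<And>D f. f \<in> Hom C D A \<Longrightarrow> m \<cdot> f = zero D B \<Longrightarrow> f = zero D A"
  shows "monic C m"
proof -
  have "f = g" if f: "f \<in> Hom C D A" and g: "g \<in> Hom C D A" and eq: "m \<cdot> f = m \<cdot> g" for D f g
  proof -
    obtain d where d: "d \<in> Hom C D A" "Add C d g = f" "d = zero D A \<Longrightarrow> f = g"
      using ex_difference[OF f g] by metis
    have "Add C (m \<cdot> d) (m \<cdot> g) = m \<cdot> g" using Comp_Add_right[OF d(1) g m] d eq by simp
    then have "m \<cdot> d = zero D B" using Add_eq_zero Comp_Hom d g m by blast
    then show ?thesis using z d by blast
  qed
  then show ?thesis unfolding monic_def using HomD[OF m] by auto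
qed

lemma epicI:
  assumes e: "e \<in> Hom C A B"
    and z: "\<And>D f. f \<in> Hom C B D \<Longrightarrow> f \<cdot> e = zero A D \<Longrightarrow> f = zero B D"
  shows "epic C e"
proof -
  have "f = g" if f: "f \<in> Hom C B D" and g: "g \<in> Hom C B D" and eq: "f \<cdot> e = g \<cdot> e" for D f g
  proof -
    obtain d where d: "d \<in> Hom C B D" "Add C d g = f" "d = zero B D \<Longrightarrow> f = g"
      using ex_difference[OF f g] by metis
    have "Add C (d \<cdot> e) (g \<cdot> e) = g \<cdot> e" using Comp_Add_left[OF e d(1) g] d eq by simp
    then have "d \<cdot> e = zero A D" using Add_eq_zero Comp_Hom d g e by blast
    then show ?thesis using z d by blast
  qed
  then show ?thesis unfolding epic_def using HomD[OF e] by auto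
qed

lemma monic_zero:
  "monic C m \<Longrightarrow> m \<in> Hom C A B \<Longrightarrow> f \<in> Hom C D A \<Longrightarrow> m \<cdot> f = zero D B \<Longrightarrow> f = zero D A"
  using monicD comp_zero_right zero_Hom HomD(4,5) by metis

lemma epic_zero:
  "epic C e \<Longrightarrow> e \<in> Hom C A B \<Longrightarrow> f \<in> Hom C B D \<Longrightarrow> f \<cdot> e = zero A D \<Longrightarrow> f = zero B D"
  using epicD comp_zero_left zero_Hom HomD(4,5) by metis

lemma kernel_props:
  assumes "is_kernel C f k" "f \<in> Hom C A B"
  shows kernel_Hom: "k \<in> Hom C (Dom C k) A" and kernel_zero: "f \<cdot> k = zero (Dom C k) B"
    and kernel_monic: "monic C k"
    and kernel_factor: "\<And>D g. g \<in> Hom C D A \<Longrightarrow> f \<cdot> g = zero D B \<Longrightarrow> \<exists>u\<in>Hom C D (Dom C k). k \<cdot> u = g"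
proof -
  show k: "k \<in> Hom C (Dom C k) A" "f \<cdot> k = zero (Dom C k) B"
    using assms HomD[OF assms(2)] unfolding is_kernel_def Hom_def by auto
  have un: "\<exists>!u. u \<in> Hom C D (Dom C k) \<and> k \<cdot> u = g"
    if "g \<in> Hom C D A" "f \<cdot> g = zero D B" for D g
    using assms HomD[OF assms(2)] HomD[OF that(1)] that unfolding is_kernel_def by auto
  then show "\<And>D g. g \<in> Hom C D A \<Longrightarrow> f \<cdot> g = zero D B \<Longrightarrow> \<exists>u\<in>Hom C D (Dom C k). k \<cdot> u = g"
    by blast
  show "monic C k"
  proof (rule monicI[OF k(1)])
    fix D u assume u: "u \<in> Hom C D (Dom C k)" "k \<cdot> u = zero D A"
    have D: "D \<in> Obj C" "A \<in> Obj C" "Dom C k \<in> Obj C" using HomD(4,5) u k by blast+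
    then have "k \<cdot> zero D (Dom C k) = zero D A" "f \<cdot> zero D A = zero D B"
      using comp_zero_right k assms(2) by blast+
    then show "u = zero D (Dom C k)"
      using un[OF zero_Hom[OF D(1,2)]] u zero_Hom[OF D(1,3)] by blast
  qed
qed

lemma cokernel_props:
  assumes "is_cokernel C f q" "f \<in> Hom C A B"
  shows cokernel_Hom: "q \<in> Hom C B (Cod C q)" and cokernel_zero: "q \<cdot> f = zero A (Cod C q)"
    and cokernel_epic: "epic C q"
    and cokernel_factor: "\<And>D g. g \<in> Hom C B D \<Longrightarrow> g \<cdot> f = zero A D \<Longrightarrow> \<exists>u\<in>Hom C (Cod C q) D. u \<cdot> q = g"
proof -
  show q: "q \<in> Hom C B (Cod C q)" "q \<cdot> f = zero A (Cod C q)"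
    using assms HomD[OF assms(2)] unfolding is_cokernel_def Hom_def by auto
  have un: "\<exists>!u. u \<in> Hom C (Cod C q) D \<and> u \<cdot> q = g"
    if "g \<in> Hom C B D" "g \<cdot> f = zero A D" for D g
    using assms HomD[OF assms(2)] HomD[OF that(1)] that unfolding is_cokernel_def by auto
  then show "\<And>D g. g \<in> Hom C B D \<Longrightarrow> g \<cdot> f = zero A D \<Longrightarrow> \<exists>u\<in>Hom C (Cod C q) D. u \<cdot> q = g"
    by blast
  show "epic C q"
  proof (rule epicI[OF q(1)])
    fix D u assume u: "u \<in> Hom C (Cod C q) D" "u \<cdot> q = zero B D"
    have D: "D \<in> Obj C" "B \<in> Obj C" "Cod C q \<in> Obj C" using HomD(4,5) u q by blast+
    then have "zero (Cod C q) D \<cdot> q = zero B D" "zero B D \<cdot> f = zero A D"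
      using comp_zero_left q assms(2) by blast+
    then show "u = zero (Cod C q) D"
      using un[OF zero_Hom[OF D(2,1)]] u zero_Hom[OF D(3,1)] by blast
  qed
qed

lemma kernelI:
  assumes f: "f \<in> Hom C A B" and k: "k \<in> Hom C K A" "f \<cdot> k = zero K B" "monic C k"
    and fac: "\<And>D g. g \<in> Hom C D A \<Longrightarrow> f \<cdot> g = zero D B \<Longrightarrow> \<exists>u\<in>Hom C D K. k \<cdot> u = g"
  shows "is_kernel C f k"
  unfolding is_kernel_def using HomD[OF f] HomD[OF k(1)] k fac monicD[OF k(3,1)]
  by auto

lemma cokernelI:
  assumes f: "f \<in> Hom C A B" and q: "q \<in> Hom C B Q" "q \<cdot> f = zero A Q" "epic C q"
    and fac: "\<And>D g. g \<in> Hom C B D \<Longrightarrow> g \<cdot> f = zero A D \<Longrightarrow> \<exists>u\<in>Hom C Q D. u \<cdot> q = g"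
  shows "is_cokernel C f q"
  unfolding is_cokernel_def using HomD[OF f] HomD[OF q(1)] q fac epicD[OF q(3,1)]
  by auto

text \<open>If \<open>m\<close> is a kernel of \<open>f\<close>, then \<open>f\<close> factors through the cokernel \<open>q\<close> of \<open>m\<close>, so whatever
  is killed by \<open>q\<close> is killed by \<open>f\<close>.\<close>

lemma monic_kernel_of_cokernel:
  assumes m: "monic C m" "m \<in> Hom C A B" and q: "is_cokernel C m q"
  shows "is_kernel C q m"
proof -
  note q' = cokernel_props[OF q m(2)]
  obtain f where f: "is_kernel C f m" using monic_is_kernel m(1) by blast
  then have fH: "f \<in> Hom C B (Cod C f)"
    using HomD[OF m(2)] unfolding is_kernel_def Hom_def by auto
  note k = kernel_props[OF f fH]
  have A: "Dom C m = A" using HomD(2)[OF m(2)] .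
  obtain t where t: "t \<in> Hom C (Cod C q) (Cod C f)" "t \<cdot> q = f"
    using q'(4)[OF fH] k(2) A by auto
  show ?thesis
  proof (rule kernelI[OF q'(1) m(2) q'(2) m(1)])
    fix D g assume g: "g \<in> Hom C D B" "q \<cdot> g = zero D (Cod C q)"
    have "f \<cdot> g = t \<cdot> (q \<cdot> g)" using t Comp_assoc[OF g(1) q'(1) t(1)] by simp
    also have "\<dots> = zero D (Cod C f)" using g comp_zero_right[OF t(1)] HomD(4,5) by metis
    finally show "\<exists>u\<in>Hom C D A. m \<cdot> u = g" using k(4)[OF g(1)] A by auto
  qed
qed

lemma epic_cokernel_of_kernel:
  assumes e: "epic C e" "e \<in> Hom C A B" and k: "is_kernel C e k"
  shows "is_cokernel C k e"
proof -
  note k' = kernel_props[OF k e(2)]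
  obtain f where f: "is_cokernel C f e" using epic_is_cokernel e(1) by blast
  then have fH: "f \<in> Hom C (Dom C f) A"
    using HomD[OF e(2)] unfolding is_cokernel_def Hom_def by auto
  note q = cokernel_props[OF f fH]
  have B: "Cod C e = B" using HomD(3)[OF e(2)] .
  obtain t where t: "t \<in> Hom C (Dom C f) (Dom C k)" "k \<cdot> t = f"
    using k'(4)[OF fH] q(2) B by auto
  show ?thesis
  proof (rule cokernelI[OF k'(1) e(2) k'(2) e(1)])
    fix D g assume g: "g \<in> Hom C A D" "g \<cdot> k = zero (Dom C k) D"
    have "g \<cdot> f = (g \<cdot> k) \<cdot> t" using t Comp_assoc[OF t(1) k'(1) g(1)] by simp
    also have "\<dots> = zero (Dom C f) D" using g comp_zero_left[OF t(1)] HomD(4,5) by metis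
    finally show "\<exists>u\<in>Hom C B D. u \<cdot> e = g" using q(4)[OF g(1)] B by auto
  qed
qed

text \<open>Such an \<open>m\<close> is the kernel of some \<open>f\<close>, which is zero because \<open>m\<close> is epic. So the identity
  factors through \<open>m\<close>.\<close>

lemma monic_epic_iso:
  assumes "monic C m" "epic C m"
  shows "iso_arrow C m"
proof -
  have m: "m \<in> Hom C (Dom C m) (Cod C m)" using assms(1) by (simp add: monic_def Hom_def)
  let ?A = "Dom C m" and ?B = "Cod C m"
  obtain f where f: "is_kernel C f m" using monic_is_kernel assms by blast
  then have fH: "f \<in> Hom C ?B (Cod C f)" unfolding is_kernel_def Hom_def by auto
  note k = kernel_props[OF f fH]
  have f0: "f = zero ?B (Cod C f)" using epic_zero[OF assms(2) m fH k(2)] .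
  have B: "?B \<in> Obj C" "?A \<in> Obj C" "Cod C f \<in> Obj C" using HomD(4,5) m fH by blast+
  have "f \<cdot> Id C ?B = zero ?B (Cod C f)" using Comp_Id_right[OF fH] f0 by simp
  then obtain s where s: "s \<in> Hom C ?B ?A" "m \<cdot> s = Id C ?B" using k(4)[OF Id_Hom[OF B(1)]] by blast
  have "m \<cdot> (s \<cdot> m) = m \<cdot> Id C ?A"
    using Comp_assoc[OF m s(1) m] s Comp_Id_left[OF m] Comp_Id_right[OF m] by simp
  then have "s \<cdot> m = Id C ?A" using monicD[OF assms(1) m] Comp_Hom[OF m s(1)] Id_Hom[OF B(2)] by blast
  then show ?thesis using iso_arrow_iff[OF m] s by blast
qed

text \<open>The kernel of the cokernel of \<open>f\<close> is the image of \<open>f\<close>: the least subobject through which \<open>f\<close>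
  factors.\<close>

lemma kernel_of_cokernel_least:
  assumes f: "f \<in> Hom C A B" and c: "is_cokernel C f c" and m: "is_kernel C c m"
    and n: "monic C n" "n \<in> Hom C N B" and w: "w \<in> Hom C A N" "n \<cdot> w = f"
  shows "\<exists>s\<in>Hom C (Dom C m) N. n \<cdot> s = m"
proof -
  note c' = cokernel_props[OF c f]
  note m' = kernel_props[OF m c'(1)]
  obtain p where p: "is_cokernel C n p" using ex_cokernel[OF HomD(1)[OF n(2)]] by blast
  note p' = cokernel_props[OF p n(2)]
  have "p \<cdot> f = (p \<cdot> n) \<cdot> w" using w Comp_assoc[OF w(1) n(2) p'(1)] by simp
  also have "\<dots> = zero A (Cod C p)" using p' comp_zero_left[OF w(1)] HomD(4,5) by metis
  finally obtain t where t: "t \<in> Hom C (Cod C c) (Cod C p)" "t \<cdot> c = p" using c'(4)[OF p'(1)] by blast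
  have "p \<cdot> m = t \<cdot> (c \<cdot> m)" using t Comp_assoc[OF m'(1) c'(1) t(1)] by simp
  also have "\<dots> = zero (Dom C m) (Cod C p)" using m'(1,2) comp_zero_right[OF t(1)] HomD(4,5) by metis
  finally show ?thesis
    using kernel_factor[OF monic_kernel_of_cokernel[OF n p] p'(1) m'(1)] HomD(2)[OF n(2)] by auto
qed

text \<open>First isomorphism theorem: the image of \<open>f\<close> is also the quotient by the kernel of \<open>f\<close>. If
  \<open>t \<cdot> e = 0\<close>, then \<open>f\<close> factors through the kernel \<open>j\<close> of \<open>t\<close> followed by \<open>m\<close>. As
  the image is least, \<open>j\<close> then has a right inverse, so \<open>t = 0\<close>; hence \<open>e\<close> is epic. An epic
  arrow is the cokernel of its kernel, and \<open>e\<close> has the same kernel as \<open>f\<close>.\<close>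

theorem image_factorization:
  assumes f: "f \<in> Hom C A B" and k: "is_kernel C f k" and c: "is_cokernel C f c" and m: "is_kernel C c m"
  obtains e where "e \<in> Hom C A (Dom C m)" "m \<cdot> e = f" "epic C e" "is_cokernel C k e"
proof -
  note c' = cokernel_props[OF c f]
  note m' = kernel_props[OF m c'(1)]
  note k' = kernel_props[OF k f]
  obtain e where e: "e \<in> Hom C A (Dom C m)" "m \<cdot> e = f" using m'(4)[OF f c'(2)] by blast
  have ep: "epic C e"
  proof (rule epicI[OF e(1)])
    fix D t assume t: "t \<in> Hom C (Dom C m) D" "t \<cdot> e = zero A D"
    obtain j where j: "is_kernel C t j" using ex_kernel[OF HomD(1)[OF t(1)]] by blast
    note j' = kernel_props[OF j t(1)]
    obtain e' where e': "e' \<in> Hom C A (Dom C j)" "j \<cdot> e' = e" using j'(4)[OF e(1) t(2)] by blast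
    have mj: "m \<cdot> j \<in> Hom C (Dom C j) B" using Comp_Hom j' m' by blast
    have "(m \<cdot> j) \<cdot> e' = f" using Comp_assoc[OF e'(1) j'(1) m'(1)] e e' by simp
    then obtain s where s: "s \<in> Hom C (Dom C m) (Dom C j)" "(m \<cdot> j) \<cdot> s = m"
      using kernel_of_cokernel_least[OF f c m monic_comp[OF j'(3,1) m'(3,1)] mj e'(1)] by blast
    have I: "Id C (Dom C m) \<in> Hom C (Dom C m) (Dom C m)" using Id_Hom HomD(4,5) e by blast
    have "m \<cdot> (j \<cdot> s) = m \<cdot> Id C (Dom C m)"
      using Comp_assoc[OF s(1) j'(1) m'(1)] s Comp_Id_right[OF m'(1)] by simp
    then have js: "j \<cdot> s = Id C (Dom C m)"
      using monicD[OF m'(3,1)] Comp_Hom[OF s(1) j'(1)] I by blast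
    have "t = t \<cdot> (j \<cdot> s)" using js Comp_Id_right[OF t(1)] by simp
    also have "\<dots> = (t \<cdot> j) \<cdot> s" using Comp_assoc[OF s(1) j'(1) t(1)] .
    also have "\<dots> = zero (Dom C m) D" using j' comp_zero_left[OF s(1)] HomD(4,5) t by metis
    finally show "t = zero (Dom C m) D" .
  qed
  have "is_kernel C e k"
  proof (rule kernelI[OF e(1) k'(1) _ k'(3)])
    have "m \<cdot> (e \<cdot> k) = zero (Dom C k) B" using Comp_assoc[OF k'(1) e(1) m'(1)] e k' by simp
    then show "e \<cdot> k = zero (Dom C k) (Dom C m)"
      using monic_zero[OF m'(3,1) Comp_Hom[OF k'(1) e(1)]] by blast
    fix D g assume g: "g \<in> Hom C D A" "e \<cdot> g = zero D (Dom C m)"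
    have "f \<cdot> g = m \<cdot> (e \<cdot> g)" using Comp_assoc[OF g(1) e(1) m'(1)] e by simp
    also have "\<dots> = zero D B" using g comp_zero_right[OF m'(1)] HomD(4,5) by metis
    finally show "\<exists>u\<in>Hom C D (Dom C k). k \<cdot> u = g" using k'(4)[OF g(1)] by blast
  qed
  then show ?thesis using that[OF e ep] epic_cokernel_of_kernel[OF ep e(1)] by blast
qed

end

section \<open>Subobjects, their quotients and simple objects\<close>

context category
begin

definition subobject :: "'o \<Rightarrow> 'm \<Rightarrow> 'm set" where
  "subobject X m = sub_equiv C X `` {m}"

lemma monics_into_iff: "m \<in> monics_into C X \<longleftrightarrow> monic C m \<and> m \<in> Hom C (Dom C m) X"
  unfolding monics_into_def monic_def Hom_def by auto

text \<open>Applied in both directions, this shows that two monics that factor through each other differ by an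
  isomorphism.\<close>

lemma monic_retraction_inverse:
  assumes "monic C m" "m \<in> Hom C A X" "h \<in> Hom C A B" "g \<in> Hom C B A" "m' \<in> Hom C B X"
    and "m' \<cdot> h = m" "m \<cdot> g = m'"
  shows "g \<cdot> h = Id C A"
proof -
  have "m \<cdot> (g \<cdot> h) = m \<cdot> Id C A"
    using Comp_assoc[OF assms(3,4,2)] assms(6,7) Comp_Id_right[OF assms(2)] by simp
  then show ?thesis
    using monicD[OF assms(1,2)] Comp_Hom[OF assms(3,4)] Id_Hom[OF HomD(4)[OF assms(2)]] by blast
qed

lemma sub_equiv_iff:
  "(m, m') \<in> sub_equiv C X \<longleftrightarrow> m \<in> monics_into C X \<and> m' \<in> monics_into C X
    \<and> factors_through m m' \<and> factors_through m' m"
proof (cases "m \<in> monics_into C X \<and> m' \<in> monics_into C X")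
  case True
  then have m: "monic C m" "m \<in> Hom C (Dom C m) X" and m': "monic C m'" "m' \<in> Hom C (Dom C m') X"
    by (auto simp: monics_into_iff)
  show ?thesis
  proof
    assume "(m, m') \<in> sub_equiv C X"
    then obtain h where h: "h \<in> Hom C (Dom C m) (Dom C m')" "iso_arrow C h" "m = m' \<cdot> h"
      unfolding sub_equiv_def by blast
    then obtain g where g: "g \<in> Hom C (Dom C m') (Dom C m)" "h \<cdot> g = Id C (Dom C m')"
      using iso_arrow_iff by blast
    have "m \<cdot> g = m'" using Comp_assoc[OF g(1) h(1) m'(2)] h g Comp_Id_right[OF m'(2)] by simp
    then show "m \<in> monics_into C X \<and> m' \<in> monics_into C X
        \<and> factors_through m m' \<and> factors_through m' m"
      using True factors_throughI[OF h(1) m'(2) h(3)[symmetric]] factors_throughI[OF g(1) m(2)]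
      by blast
  next
    assume "m \<in> monics_into C X \<and> m' \<in> monics_into C X
        \<and> factors_through m m' \<and> factors_through m' m"
    then obtain h g where hg: "h \<in> Hom C (Dom C m) (Dom C m')" "m' \<cdot> h = m"
        "g \<in> Hom C (Dom C m') (Dom C m)" "m \<cdot> g = m'"
      unfolding factors_through_def by metis
    have "g \<cdot> h = Id C (Dom C m)" "h \<cdot> g = Id C (Dom C m')"
      using monic_retraction_inverse[OF m hg(1,3) m'(2) hg(2,4)]
        monic_retraction_inverse[OF m' hg(3,1) m(2) hg(4,2)] by auto
    then have "iso_arrow C h" using iso_arrow_iff[OF hg(1)] hg(3) by blast
    then show "(m, m') \<in> sub_equiv C X" unfolding sub_equiv_def using True hg by blast
  qed
qed (auto simp: sub_equiv_def)

lemma factors_through_refl: "m \<in> Hom C A X \<Longrightarrow> factors_through m m"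
  using factors_throughI[OF Id_Hom _ Comp_Id_right] HomD(4) by blast

lemma factors_through_trans:
  assumes "l \<in> Hom C A X" "m \<in> Hom C B X" "n \<in> Hom C D X"
    and "factors_through l m" "factors_through m n"
  shows "factors_through l n"
proof -
  obtain h where h: "h \<in> Hom C A B" "m \<cdot> h = l" using factors_throughE[OF assms(4,1,2)] .
  obtain g where g: "g \<in> Hom C B D" "n \<cdot> g = m" using factors_throughE[OF assms(5,2,3)] .
  show ?thesis
    using factors_throughI[OF Comp_Hom[OF h(1) g(1)] assms(3)] Comp_assoc[OF h(1) g(1) assms(3)] h g
    by simp
qed

lemma equiv_sub_equiv: "equiv (monics_into C X) (sub_equiv C X)"
proof (rule equivI)
  show "sub_equiv C X \<subseteq> monics_into C X \<times> monics_into C X" by (auto simp: sub_equiv_iff)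
  show "refl_on (monics_into C X) (sub_equiv C X)"
    by (rule refl_onI) (auto simp: sub_equiv_iff monics_into_iff intro: factors_through_refl)
  show "sym (sub_equiv C X)" by (rule symI) (auto simp: sub_equiv_iff)
  show "trans (sub_equiv C X)"
    by (rule transI) (auto simp: sub_equiv_iff monics_into_iff intro: factors_through_trans)
qed

lemma subobject_in: "m \<in> monics_into C X \<Longrightarrow> subobject X m \<in> subobjects C X"
  unfolding subobject_def subobjects_def by (rule quotientI)

lemma subobjectsE:
  assumes "S \<in> subobjects C X"
  obtains m where "m \<in> monics_into C X" "S = subobject X m"
  using assms unfolding subobject_def subobjects_def by (auto elim: quotientE)

lemma subobjects_eq_image: "subobjects C X = subobject X ` monics_into C X"
  unfolding subobjects_def subobject_def quotient_def by blast

lemma mem_subobject_iff: "m' \<in> subobject X m \<longleftrightarrow> (m, m') \<in> sub_equiv C X"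
  unfolding subobject_def by simp

lemma mem_subobject_self: "m \<in> monics_into C X \<Longrightarrow> m \<in> subobject X m"
  unfolding subobject_def using equiv_class_self[OF equiv_sub_equiv] by blast

lemma subobject_eq_mem: "S \<in> subobjects C X \<Longrightarrow> m \<in> S \<Longrightarrow> m \<in> monics_into C X \<and> S = subobject X m"
  unfolding subobject_def subobjects_def
  using quotient_eq_iff[OF equiv_sub_equiv] equiv_class_eq_iff[OF equiv_sub_equiv]
  by (metis Image_singleton_iff quotientE equiv_sub_equiv)

lemma subobject_eq_iff:
  assumes "m \<in> monics_into C X" "m' \<in> monics_into C X"
  shows "subobject X m = subobject X m' \<longleftrightarrow> factors_through m m' \<and> factors_through m' m"
  unfolding subobject_def using eq_equiv_class_iff[OF equiv_sub_equiv assms] assms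
  by (simp add: sub_equiv_iff)

lemma sub_le_subobject:
  assumes m: "m \<in> monics_into C X" "m' \<in> monics_into C X"
  shows "sub_le C (subobject X m) (subobject X m') \<longleftrightarrow> factors_through m m'"
proof
  assume "sub_le C (subobject X m) (subobject X m')"
  then obtain l l' where l: "l \<in> subobject X m" "l' \<in> subobject X m'" "factors_through l l'"
    unfolding sub_le_def factors_through_def by blast
  then have "l \<in> monics_into C X" "l' \<in> monics_into C X" "factors_through m l" "factors_through l' m'"
    by (auto simp: mem_subobject_iff sub_equiv_iff)
  then show "factors_through m m'"
    using l(3) m factors_through_trans unfolding monics_into_iff by metis
next
  assume "factors_through m m'"
  then show "sub_le C (subobject X m) (subobject X m')"
    unfolding sub_le_def factors_through_def using mem_subobject_self m by blast
qed

lemma whole_sub_eq: "whole_sub C X = subobject X (Id C X)"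
  unfolding whole_sub_def subobject_def ..

lemma Id_monics_into: "X \<in> Obj C \<Longrightarrow> Id C X \<in> monics_into C X"
proof -
  assume X: "X \<in> Obj C"
  note I = Id_Hom[OF X]
  have "iso_arrow C (Id C X)" using iso_arrow_iff[OF I] I Comp_Id_left[OF I] by blast
  then show ?thesis using iso_arrow_monic I HomD(2,3)[OF I] by (simp add: monics_into_iff)
qed

lemma subobject_eq_whole_iff:
  assumes "X \<in> Obj C" "m \<in> monics_into C X"
  shows "subobject X m = whole_sub C X \<longleftrightarrow> iso_arrow C m"
proof -
  have m: "m \<in> Hom C (Dom C m) X" "monic C m" using assms by (auto simp: monics_into_iff)
  note I = Id_Hom[OF assms(1)]
  have le: "factors_through m (Id C X)" using factors_throughI[OF m(1) I Comp_Id_left[OF m(1)]] .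
  have "factors_through (Id C X) m \<longleftrightarrow> iso_arrow C m"
  proof
    assume "factors_through (Id C X) m"
    then obtain s where s: "s \<in> Hom C X (Dom C m)" "m \<cdot> s = Id C X"
      using factors_throughE[OF _ I m(1)] by blast
    have "s \<cdot> m = Id C (Dom C m)"
      using monic_retraction_inverse[OF m(2,1) m(1) s(1) I Comp_Id_left[OF m(1)] s(2)] .
    then show "iso_arrow C m" using iso_arrow_iff[OF m(1)] s by blast
  next
    assume "iso_arrow C m"
    then obtain s where s: "s \<in> Hom C X (Dom C m)" "m \<cdot> s = Id C X"
      using iso_arrow_iff[OF m(1)] by blast
    then show "factors_through (Id C X) m" using factors_throughI[OF s(1) m(1) s(2)] by blast
  qed
  then show ?thesis
    unfolding whole_sub_eq using subobject_eq_iff[OF assms(2) Id_monics_into[OF assms(1)]] le by blast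
qed

end

context abelian_category
begin

lemma zero_object_iff: "zero_object C Z \<longleftrightarrow> Z \<in> Obj C \<and> Id C Z = zero Z Z"
proof
  assume z: "zero_object C Z"
  then have Z: "Z \<in> Obj C" "\<exists>!f. f \<in> Hom C Z Z" unfolding zero_object_def by auto
  then show "Z \<in> Obj C \<and> Id C Z = zero Z Z" using Id_Hom[OF Z(1)] zero_Hom[OF Z(1,1)] by blast
next
  assume z: "Z \<in> Obj C \<and> Id C Z = zero Z Z"
  have "f = zero A Z" if "f \<in> Hom C A Z" for f A
    using Comp_Id_left[OF that] comp_zero_left[OF that, of Z] z by simp
  moreover have "f = zero Z A" if "f \<in> Hom C Z A" for f A
    using Comp_Id_right[OF that] comp_zero_right[OF that, of Z] z by simp
  ultimately show "zero_object C Z" unfolding zero_object_def using z zero_Hom by metis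
qed

lemma Hom_into_zero: "zero_object C Z \<Longrightarrow> f \<in> Hom C A Z \<Longrightarrow> f = zero A Z"
  unfolding zero_object_def using zero_Hom HomD(4,5) by metis

lemma Hom_from_zero: "zero_object C Z \<Longrightarrow> f \<in> Hom C Z A \<Longrightarrow> f = zero Z A"
  unfolding zero_object_def using zero_Hom HomD(4,5) by metis

lemma zero_object_monic: "zero_object C Z \<Longrightarrow> z \<in> Hom C Z X \<Longrightarrow> monic C z"
  by (rule monicI) (auto intro: Hom_into_zero)

lemma zero_object_if_monic_zero:
  assumes "monic C m" "m \<in> Hom C A B" "m = zero A B" shows "zero_object C A"
proof -
  note A = HomD(4)[OF assms(2)]
  show ?thesis using monic_zero[OF assms(1,2) Id_Hom[OF A]] Comp_Id_right[OF assms(2)] assms(3) A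
    by (simp add: zero_object_iff)
qed

lemma monic_into_zero_object: "monic C m \<Longrightarrow> m \<in> Hom C A Z \<Longrightarrow> zero_object C Z \<Longrightarrow> zero_object C A"
  using zero_object_if_monic_zero Hom_into_zero by blast

lemma zero_sub_eq:
  assumes Z: "zero_object C Z" and z: "z \<in> Hom C Z X"
  shows "z \<in> monics_into C X" "zero_sub C X = subobject X z"
proof -
  show zm: "z \<in> monics_into C X"
    using zero_object_monic[OF assms] z HomD(2)[OF z] by (simp add: monics_into_iff)
  have "m \<in> zero_sub C X \<longleftrightarrow> m \<in> subobject X z" for m
  proof
    assume "m \<in> zero_sub C X"
    then have m: "m \<in> monics_into C X" "zero_object C (Dom C m)" unfolding zero_sub_def by auto
    then have mH: "m \<in> Hom C (Dom C m) X" by (simp add: monics_into_iff)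
    have "u \<cdot> v = w" if "zero_object C A" "v \<in> Hom C A B" "u \<in> Hom C B X" "w \<in> Hom C A X" for A B u v w
      using Hom_from_zero[OF that(1)] Comp_Hom[OF that(2,3)] that(4) by metis
    moreover have "zero Z (Dom C m) \<in> Hom C Z (Dom C m)" "zero (Dom C m) Z \<in> Hom C (Dom C m) Z"
      using zero_Hom HomD(4)[OF z] HomD(4)[OF mH] by auto
    ultimately have "factors_through m z" "factors_through z m"
      using factors_throughI z mH Z m by blast+
    then show "m \<in> subobject X z" using m zm by (simp add: mem_subobject_iff sub_equiv_iff)
  next
    assume "m \<in> subobject X z"
    then have m: "m \<in> monics_into C X" "factors_through m z"
      by (auto simp: mem_subobject_iff sub_equiv_iff)
    then have mH: "m \<in> Hom C (Dom C m) X" "monic C m" by (auto simp: monics_into_iff)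
    obtain h where h: "h \<in> Hom C (Dom C m) Z" "z \<cdot> h = m" using factors_throughE[OF m(2) mH(1) z] .
    have "monic C h"
    proof (rule monicI[OF h(1)])
      fix D f assume f: "f \<in> Hom C D (Dom C m)" "h \<cdot> f = zero D Z"
      have "m \<cdot> f = zero D X"
        using Comp_assoc[OF f(1) h(1) z] h f comp_zero_right[OF z HomD(4)[OF f(1)]] by simp
      then show "f = zero D (Dom C m)" using monic_zero[OF mH(2,1) f(1)] by blast
    qed
    then have "zero_object C (Dom C m)" using monic_into_zero_object h Z by blast
    then show "m \<in> zero_sub C X" unfolding zero_sub_def using m by blast
  qed
  then show "zero_sub C X = subobject X z" by blast
qed

lemma ex_zero_monic:
  assumes "X \<in> Obj C" obtains Z z where "zero_object C Z" "z \<in> Hom C Z X"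
  using ex_zero_object assms zero_Hom unfolding zero_object_def by metis

lemma subobject_eq_zero_iff:
  assumes "X \<in> Obj C" "m \<in> monics_into C X"
  shows "subobject X m = zero_sub C X \<longleftrightarrow> zero_object C (Dom C m)"
proof
  assume "subobject X m = zero_sub C X"
  then have "m \<in> zero_sub C X" using mem_subobject_self assms by blast
  then show "zero_object C (Dom C m)" unfolding zero_sub_def by blast
next
  assume "zero_object C (Dom C m)"
  then show "subobject X m = zero_sub C X" using zero_sub_eq assms monics_into_iff by blast
qed

lemma simple_object_iff:
  "simple_object C Q \<longleftrightarrow> Q \<in> Obj C \<and> \<not> zero_object C Q \<and>
    (\<forall>N n. n \<in> Hom C N Q \<longrightarrow> monic C n \<longrightarrow> zero_object C N \<or> iso_arrow C n)"
proof (cases "Q \<in> Obj C")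
  case True
  have "(\<forall>S\<in>subobjects C Q. S = zero_sub C Q \<or> S = whole_sub C Q) \<longleftrightarrow>
      (\<forall>n\<in>monics_into C Q. zero_object C (Dom C n) \<or> iso_arrow C n)"
    using subobject_eq_zero_iff[OF True] subobject_eq_whole_iff[OF True]
    by (simp add: subobjects_eq_image)
  also have "\<dots> \<longleftrightarrow> (\<forall>N n. n \<in> Hom C N Q \<longrightarrow> monic C n \<longrightarrow> zero_object C N \<or> iso_arrow C n)"
  proof (intro iffI allI impI ballI)
    fix N n
    assume all: "\<forall>n\<in>monics_into C Q. zero_object C (Dom C n) \<or> iso_arrow C n"
      and n: "n \<in> Hom C N Q" "monic C n"
    have "Dom C n = N" using HomD(2)[OF n(1)] .
    then show "zero_object C N \<or> iso_arrow C n" using all n by (auto simp: monics_into_iff)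
  qed (auto simp: monics_into_iff)
  finally show ?thesis unfolding simple_object_def using True by blast
qed (auto simp: simple_object_def)

lemma simple_object_isomorphic:
  assumes iso: "isomorphic C Q Q'" and s: "simple_object C Q"
  shows "simple_object C Q'"
proof -
  obtain f g where f: "f \<in> Hom C Q Q'" and g: "g \<in> Hom C Q' Q" and gf: "g \<cdot> f = Id C Q"
    and fg: "f \<cdot> g = Id C Q'"
    using iso unfolding isomorphic_iff by blast
  have if': "iso_arrow C f" "iso_arrow C g"
    using iso_arrow_iff[OF f] iso_arrow_iff[OF g] f g fg gf by auto
  have nz: "\<not> zero_object C Q'"
    using monic_into_zero_object[OF iso_arrow_monic[OF if'(1)] f] s by (auto simp: simple_object_iff)
  have "zero_object C N \<or> iso_arrow C n" if n: "n \<in> Hom C N Q'" "monic C n" for N n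
  proof -
    have gn: "g \<cdot> n \<in> Hom C N Q" using Comp_Hom n g by blast
    have eq: "f \<cdot> (g \<cdot> n) = n" using Comp_assoc[OF n(1) g f] fg Comp_Id_left[OF n(1)] by simp
    have "monic C (g \<cdot> n)" using monic_comp[OF n(2,1) iso_arrow_monic[OF if'(2)] g] .
    then consider "zero_object C N" | "iso_arrow C (g \<cdot> n)" using s gn unfolding simple_object_iff by blast
    then show ?thesis
    proof cases
      case 2
      then obtain r where r: "r \<in> Hom C Q N" "r \<cdot> (g \<cdot> n) = Id C N" "(g \<cdot> n) \<cdot> r = Id C Q"
        using iso_arrow_iff[OF gn] by blast
      have 1: "(r \<cdot> g) \<cdot> n = Id C N" using Comp_assoc[OF n(1) g r(1)] r by simp
      have "r \<cdot> g \<in> Hom C Q' N" using Comp_Hom g r by blast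
      moreover have "n \<cdot> (r \<cdot> g) = Id C Q'"
        using inverse_comp[OF g f fg r(1) gn r(3)] eq by simp
      ultimately show ?thesis using 1 iso_arrow_iff[OF n(1)] by blast
    qed simp
  qed
  then show ?thesis unfolding simple_object_iff using isomorphic_Obj[OF iso] nz by blast
qed

lemma cokernel_map:
  assumes h: "h \<in> Hom C A B" and h1: "h1 \<in> Hom C A1 B1"
    and q: "is_cokernel C h q" and q1: "is_cokernel C h1 q1"
    and j: "j \<in> Hom C B B1" and i: "i \<in> Hom C A A1" and eq: "j \<cdot> h = h1 \<cdot> i"
  shows "\<exists>u\<in>Hom C (Cod C q) (Cod C q1). u \<cdot> q = q1 \<cdot> j"
proof -
  note q' = cokernel_props[OF q h] and q1' = cokernel_props[OF q1 h1]
  have "(q1 \<cdot> j) \<cdot> h = (q1 \<cdot> h1) \<cdot> i"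
    using Comp_assoc[OF h j q1'(1)] Comp_assoc[OF i h1 q1'(1)] eq by simp
  also have "\<dots> = zero A (Cod C q1)"
    using q1'(2) comp_zero_left[OF i HomD(5)[OF q1'(1)]] by simp
  finally show ?thesis using q'(4)[OF Comp_Hom[OF j q1'(1)]] by blast
qed

text \<open>The hypotheses on \<open>i\<close> and \<open>i'\<close> say that \<open>j\<close> identifies \<open>h\<close> and \<open>h1\<close> up to mutual
  factorization. Both arrows between the cokernels are induced by \<open>j\<close> and its inverse, and they
  are mutually inverse by cancelling the epics \<open>q\<close> and \<open>q1\<close>.\<close>

lemma cokernels_isomorphic:
  assumes h: "h \<in> Hom C A B" and h1: "h1 \<in> Hom C A1 B1"
    and q: "is_cokernel C h q" and q1: "is_cokernel C h1 q1"
    and j: "j \<in> Hom C B B1" "j' \<in> Hom C B1 B" "j' \<cdot> j = Id C B" "j \<cdot> j' = Id C B1"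
    and i: "i \<in> Hom C A A1" "j \<cdot> h = h1 \<cdot> i" and i': "i' \<in> Hom C A1 A" "j' \<cdot> h1 = h \<cdot> i'"
  shows "isomorphic C (Cod C q) (Cod C q1)"
proof -
  note q' = cokernel_props[OF q h] and q1' = cokernel_props[OF q1 h1]
  obtain u where u: "u \<in> Hom C (Cod C q) (Cod C q1)" "u \<cdot> q = q1 \<cdot> j"
    using cokernel_map[OF h h1 q q1 j(1) i] by blast
  obtain v where v: "v \<in> Hom C (Cod C q1) (Cod C q)" "v \<cdot> q1 = q \<cdot> j'"
    using cokernel_map[OF h1 h q1 q j(2) i'] by blast
  have inv: "b \<cdot> a = Id C Q"
    if a: "a \<in> Hom C Q P" "a \<cdot> s = t \<cdot> x" and b: "b \<in> Hom C P Q" "b \<cdot> t = s \<cdot> y"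
      and s: "s \<in> Hom C U Q" "epic C s" and t: "t \<in> Hom C V P"
      and x: "x \<in> Hom C U V" and y: "y \<in> Hom C V U" "y \<cdot> x = Id C U"
    for a b s t x y Q P U V
  proof -
    have "(b \<cdot> a) \<cdot> s = (b \<cdot> t) \<cdot> x"
      using Comp_assoc[OF s(1) a(1) b(1)] a(2) Comp_assoc[OF x t b(1)] by simp
    also have "\<dots> = Id C Q \<cdot> s"
      using b(2) Comp_assoc[OF x y(1) s(1)] y(2) Comp_Id_right[OF s(1)] Comp_Id_left[OF s(1)] by simp
    finally show ?thesis
      using epicD[OF s(2,1) Comp_Hom[OF a(1) b(1)] Id_Hom[OF HomD(5)[OF s(1)]]] by blast
  qed
  show ?thesis unfolding isomorphic_iff
    using u(1) v(1) inv[OF u v q'(1,3) q1'(1) j(1-3)] inv[OF v u q1'(1,3) q'(1) j(2,1,4)] by blast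
qed

lemma is_quotient_unique:
  assumes S: "S \<in> subobjects C X" and T: "T \<in> subobjects C X"
    and Q: "is_quotient C T S Q" and Q1: "is_quotient C T S Q1"
  shows "isomorphic C Q Q1"
proof -
  obtain m m' h q where m: "m \<in> S" "m' \<in> T" and h: "h \<in> Hom C (Dom C m) (Dom C m')" "m = m' \<cdot> h"
    and q: "is_cokernel C h q" "Cod C q = Q"
    using Q unfolding is_quotient_def by blast
  obtain m1 m1' h1 q1 where m1: "m1 \<in> S" "m1' \<in> T" and h1: "h1 \<in> Hom C (Dom C m1) (Dom C m1')" "m1 = m1' \<cdot> h1"
    and q1: "is_cokernel C h1 q1" "Cod C q1 = Q1"
    using Q1 unfolding is_quotient_def by blast
  have mm: "n \<in> monics_into C X" "n' \<in> monics_into C X" "factors_through n n'"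
    if "n \<in> R" "n' \<in> R" "R \<in> subobjects C X" for n n' R
    using subobject_eq_mem[OF that(3,1)] subobject_eq_mem[OF that(3,2)] subobject_eq_iff by auto
  have H: "monic C m" "m \<in> Hom C (Dom C m) X" "monic C m'" "m' \<in> Hom C (Dom C m') X"
    "monic C m1" "m1 \<in> Hom C (Dom C m1) X" "monic C m1'" "m1' \<in> Hom C (Dom C m1') X"
    using mm[OF m(1) m1(1) S] mm[OF m(2) m1(2) T] by (auto simp: monics_into_iff)
  obtain i where i: "i \<in> Hom C (Dom C m) (Dom C m1)" "m1 \<cdot> i = m"
    using factors_throughE[OF mm(3)[OF m(1) m1(1) S] H(2,6)] .
  obtain i' where i': "i' \<in> Hom C (Dom C m1) (Dom C m)" "m \<cdot> i' = m1"
    using factors_throughE[OF mm(3)[OF m1(1) m(1) S] H(6,2)] .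
  obtain j where j: "j \<in> Hom C (Dom C m') (Dom C m1')" "m1' \<cdot> j = m'"
    using factors_throughE[OF mm(3)[OF m(2) m1(2) T] H(4,8)] .
  obtain j' where j': "j' \<in> Hom C (Dom C m1') (Dom C m')" "m' \<cdot> j' = m1'"
    using factors_throughE[OF mm(3)[OF m1(2) m(2) T] H(8,4)] .
  have jj: "j' \<cdot> j = Id C (Dom C m')" "j \<cdot> j' = Id C (Dom C m1')"
    using monic_retraction_inverse[OF H(3,4) j(1) j'(1) H(8) j(2) j'(2)]
      monic_retraction_inverse[OF H(7,8) j'(1) j(1) H(4) j'(2) j(2)] by auto
  have "m1' \<cdot> (j \<cdot> h) = m1' \<cdot> (h1 \<cdot> i)"
    using Comp_assoc[OF h(1) j(1) H(8)] Comp_assoc[OF i(1) h1(1) H(8)] i j h h1 by simp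
  then have 1: "j \<cdot> h = h1 \<cdot> i"
    using monicD[OF H(7,8)] Comp_Hom[OF h(1) j(1)] Comp_Hom[OF i(1) h1(1)] by blast
  have "m' \<cdot> (j' \<cdot> h1) = m' \<cdot> (h \<cdot> i')"
    using Comp_assoc[OF h1(1) j'(1) H(4)] Comp_assoc[OF i'(1) h(1) H(4)] i' j' h h1 by simp
  then have 2: "j' \<cdot> h1 = h \<cdot> i'"
    using monicD[OF H(3,4)] Comp_Hom[OF h1(1) j'(1)] Comp_Hom[OF i'(1) h(1)] by blast
  show ?thesis
    using cokernels_isomorphic[OF h(1) h1(1) q(1) q1(1) j(1) j'(1) jj i(1) 1 i'(1) 2] q q1 by simp
qed

text \<open>The quotient chosen by \<open>quotient_obj\<close> can be computed from any pair of representatives.\<close>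

lemma quotient_obj_isomorphic:
  assumes m: "m \<in> monics_into C X" "m \<in> Hom C A X" and m': "m' \<in> monics_into C X" "m' \<in> Hom C A' X"
    and h: "h \<in> Hom C A A'" "m' \<cdot> h = m" and q: "is_cokernel C h q"
  shows "isomorphic C (quotient_obj C (subobject X m') (subobject X m)) (Cod C q)"
proof -
  have "is_quotient C (subobject X m') (subobject X m) (Cod C q)"
    unfolding is_quotient_def
    using mem_subobject_self m m' h q HomD(2)[OF m(2)] HomD(2)[OF m'(2)] by blast
  moreover from this have
    "is_quotient C (subobject X m') (subobject X m) (quotient_obj C (subobject X m') (subobject X m))"
    unfolding quotient_obj_def by (rule someI)
  ultimately show ?thesis using is_quotient_unique subobject_in m m' by blast
qed

end

section \<open>The lattice of subobjects, labelled by simple quotients\<close>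

context abelian_category
begin

text \<open>Write \<open>q\<close> for the projection to the simple quotient \<open>Q\<close>. The image of \<open>U\<close> in \<open>Q\<close> is either
  zero or \<open>Q\<close>. In the first case \<open>U\<close> lies in the kernel of \<open>q\<close>. In the second case the
  inclusion of \<open>U\<close> into \<open>M'\<close> is epic: an arrow that vanishes on \<open>U\<close> vanishes on \<open>M\<close>, hence
  factors through \<open>q\<close>, and it is then zero since \<open>U\<close> maps onto \<open>Q\<close>.\<close>

lemma simple_quotient_nothing_between:
  assumes m: "monic C m" "m \<in> Hom C M X" and m': "monic C m'" "m' \<in> Hom C M' X"
    and u: "monic C u" "u \<in> Hom C U X"
    and h: "h \<in> Hom C M M'" "m' \<cdot> h = m" and q: "is_cokernel C h q"
    and simple: "simple_object C (Cod C q)"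
    and mu: "factors_through m u" and um': "factors_through u m'"
  shows "factors_through u m \<or> factors_through m' u"
proof -
  note q' = cokernel_props[OF q h(1)]
  have hm: "monic C h" using monic_first_factor[OF _ h(1) m'(2)] h m by simp
  obtain h1 where h1: "h1 \<in> Hom C M U" "u \<cdot> h1 = m" using factors_throughE[OF mu m(2) u(2)] .
  obtain h2 where h2: "h2 \<in> Hom C U M'" "m' \<cdot> h2 = u" using factors_throughE[OF um' u(2) m'(2)] .
  have f: "q \<cdot> h2 \<in> Hom C U (Cod C q)" (is "?f \<in> _") using Comp_Hom[OF h2(1) q'(1)] .
  obtain k c where k: "is_kernel C ?f k" and c: "is_cokernel C ?f c"
    using ex_kernel ex_cokernel HomD(1)[OF f] by blast
  note c' = cokernel_props[OF c f]
  obtain i where i: "is_kernel C c i" using ex_kernel HomD(1)[OF c'(1)] by blast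
  note i' = kernel_props[OF i c'(1)]
  obtain e where e: "e \<in> Hom C U (Dom C i)" "i \<cdot> e = ?f" "epic C e"
    using image_factorization[OF f k c i] by blast
  consider "zero_object C (Dom C i)" | "iso_arrow C i"
    using simple i'(1,3) unfolding simple_object_iff by blast
  then show ?thesis
  proof cases
    case 1
    then have "e = zero U (Dom C i)" using Hom_into_zero e by blast
    then have "q \<cdot> h2 = zero U (Cod C q)"
      using e(2) comp_zero_right[OF i'(1) HomD(4)[OF e(1)]] by simp
    then obtain w where w: "w \<in> Hom C U M" "h \<cdot> w = h2"
      using kernel_factor[OF monic_kernel_of_cokernel[OF hm h(1) q] q'(1) h2(1)] HomD(2)[OF h(1)]
      by auto
    have "m \<cdot> w = u" using Comp_assoc[OF w(1) h(1) m'(2)] w h h2 by simp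
    then show ?thesis using factors_throughI[OF w(1) m(2)] by blast
  next
    case 2
    then have fe: "epic C ?f" using epic_comp[OF e(3,1) iso_arrow_epic i'(1)] e(2) by simp
    have "m' \<cdot> (h2 \<cdot> h1) = m' \<cdot> h" using Comp_assoc[OF h1(1) h2(1) m'(2)] h1 h2 h by simp
    then have hh: "h2 \<cdot> h1 = h" using monicD[OF m' Comp_Hom[OF h1(1) h2(1)] h(1)] by blast
    have "epic C h2"
    proof (rule epicI[OF h2(1)])
      fix D g assume g: "g \<in> Hom C M' D" "g \<cdot> h2 = zero U D"
      have "g \<cdot> h = zero M D"
        using Comp_assoc[OF h1(1) h2(1) g(1)] hh g(2) comp_zero_left[OF h1(1) HomD(5)[OF g(1)]] by simp
      then obtain t where t: "t \<in> Hom C (Cod C q) D" "t \<cdot> q = g" using q'(4)[OF g(1)] by blast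
      have "t \<cdot> ?f = zero U D" using Comp_assoc[OF h2(1) q'(1) t(1)] t g by simp
      then have "t = zero (Cod C q) D" using epic_zero[OF fe f t(1)] by blast
      then show "g = zero M' D" using t comp_zero_left[OF q'(1) HomD(5)[OF g(1)]] by simp
    qed
    moreover have "monic C h2" using monic_first_factor[OF _ h2(1) m'(2)] h2 u by simp
    ultimately obtain s where s: "s \<in> Hom C M' U" "h2 \<cdot> s = Id C M'"
      using monic_epic_iso iso_arrow_iff[OF h2(1)] by blast
    have "u \<cdot> s = m'" using Comp_assoc[OF s(1) h2(1) m'(2)] h2 s Comp_Id_right[OF m'(2)] by simp
    then show ?thesis using factors_throughI[OF s(1) u(2)] by blast
  qed
qed

lemma simple_quotient_strict:
  assumes m: "monic C m" "m \<in> Hom C M X" and m': "monic C m'" "m' \<in> Hom C M' X"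
    and h: "h \<in> Hom C M M'" "m' \<cdot> h = m" and q: "is_cokernel C h q"
    and simple: "simple_object C (Cod C q)"
  shows "\<not> factors_through m' m"
proof
  assume "factors_through m' m"
  note q' = cokernel_props[OF q h(1)]
  obtain s where s: "s \<in> Hom C M' M" "m \<cdot> s = m'"
    using factors_throughE[OF \<open>factors_through m' m\<close> m'(2) m(2)] .
  have "h \<cdot> s = Id C M'" using monic_retraction_inverse[OF m' s(1) h(1) m(2) s(2) h(2)] .
  then have "q = (q \<cdot> h) \<cdot> s" using Comp_assoc[OF s(1) h(1) q'(1)] Comp_Id_right[OF q'(1)] by simp
  also have "\<dots> = zero M' (Cod C q)" using q'(2) comp_zero_left[OF s(1) HomD(5)[OF q'(1)]] by simp
  finally have q0: "q = zero M' (Cod C q)" .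
  note Q = HomD(5)[OF q'(1)]
  have "Id C (Cod C q) \<cdot> q = zero M' (Cod C q)" using Comp_Id_left[OF q'(1)] q0 by simp
  then have "Id C (Cod C q) = zero (Cod C q) (Cod C q)"
    using epic_zero[OF q'(3,1) Id_Hom[OF Q]] by blast
  then have "zero_object C (Cod C q)" using zero_object_iff Q by blast
  then show False using simple simple_object_iff by blast
qed

text \<open>Let \<open>c\<close> be the projection from \<open>X\<close> to \<open>X/B\<close> and \<open>f\<close> its restriction to \<open>A\<close>. The meet is
  the kernel of \<open>f\<close>, and the join is the kernel of the composite of \<open>c\<close> with the cokernel of
  \<open>f\<close>. The kernel of the restriction \<open>g\<close> of \<open>c\<close> to
  the join \<open>J\<close> is \<open>B\<close>. By the image factorization, \<open>A/M\<close> is the image of \<open>f\<close> and \<open>J/B\<close>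
  is the image of \<open>g\<close>. These images agree: \<open>f\<close> factors through \<open>g\<close>, and \<open>g\<close> is killed by
  the cokernel of \<open>f\<close>.\<close>

theorem second_isomorphism:
  assumes a: "monic C a" "a \<in> Hom C A X" and b: "monic C b" "b \<in> Hom C B X"
  obtains M m J j where
    "monic C m" "m \<in> Hom C M X" "monic C j" "j \<in> Hom C J X"
    "factors_through m a" "factors_through m b"
    "\<And>D u. u \<in> Hom C D X \<Longrightarrow> factors_through u a \<Longrightarrow> factors_through u b \<Longrightarrow> factors_through u m"
    "factors_through a j" "factors_through b j"
    "\<And>D u. monic C u \<Longrightarrow> u \<in> Hom C D X \<Longrightarrow> factors_through a u \<Longrightarrow> factors_through b u
      \<Longrightarrow> factors_through j u"
    "isomorphic C (quotient_obj C (subobject X a) (subobject X m))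
      (quotient_obj C (subobject X j) (subobject X b))"
proof -
  obtain c where c: "is_cokernel C b c" using ex_cokernel HomD(1)[OF b(2)] by blast
  define Q where "Q = Cod C c"
  note c' = cokernel_props[OF c b(2), folded Q_def]
  have bk: "is_kernel C c b" using monic_kernel_of_cokernel[OF b c] .
  have Bd: "Dom C b = B" using HomD(2)[OF b(2)] .
  define f where "f = c \<cdot> a"
  have f: "f \<in> Hom C A Q" unfolding f_def using Comp_Hom[OF a(2) c'(1)] .
  obtain k d where k: "is_kernel C f k" and d: "is_cokernel C f d"
    using ex_kernel ex_cokernel HomD(1)[OF f] by blast
  define K where "K = Dom C k"
  note k' = kernel_props[OF k f, folded K_def]
  note d' = cokernel_props[OF d f]
  have dc: "d \<cdot> c \<in> Hom C X (Cod C d)" using Comp_Hom[OF c'(1) d'(1)] .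
  obtain j where j: "is_kernel C (d \<cdot> c) j" using ex_kernel HomD(1)[OF dc] by blast
  define J where "J = Dom C j"
  note j' = kernel_props[OF j dc, folded J_def]
  define m where "m = a \<cdot> k"
  have m: "monic C m" "m \<in> Hom C K X"
    unfolding m_def using monic_comp[OF k'(3,1) a] Comp_Hom[OF k'(1) a(2)] by auto
  have ma: "factors_through m a" using factors_throughI[OF k'(1) a(2)] m_def by blast
  have "c \<cdot> m = zero K Q"
    unfolding m_def using Comp_assoc[OF k'(1) a(2) c'(1)] k'(2) f_def by simp
  then obtain w where "w \<in> Hom C K B" "b \<cdot> w = m"
    using kernel_factor[OF bk c'(1) m(2)] Bd by auto
  then have mb: "factors_through m b" using factors_throughI b(2) by blast
  have glb: "factors_through u m"
    if u: "u \<in> Hom C D X" "factors_through u a" "factors_through u b" for D u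
  proof -
    obtain v where v: "v \<in> Hom C D A" "a \<cdot> v = u" using factors_throughE[OF u(2,1) a(2)] .
    obtain w where w: "w \<in> Hom C D B" "b \<cdot> w = u" using factors_throughE[OF u(3,1) b(2)] .
    have "f \<cdot> v = (c \<cdot> b) \<cdot> w"
      unfolding f_def using Comp_assoc[OF v(1) a(2) c'(1)] Comp_assoc[OF w(1) b(2) c'(1)] v w by simp
    also have "\<dots> = zero D Q" using c'(2) comp_zero_left[OF w(1) HomD(5)[OF c'(1)]] by simp
    finally obtain x where x: "x \<in> Hom C D K" "k \<cdot> x = v" using k'(4)[OF v(1)] by blast
    have "m \<cdot> x = u" unfolding m_def using Comp_assoc[OF x(1) k'(1) a(2)] x v by simp
    then show ?thesis using factors_throughI[OF x(1) m(2)] by blast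
  qed
  have "(d \<cdot> c) \<cdot> a = zero A (Cod C d)"
    using Comp_assoc[OF a(2) c'(1) d'(1)] d'(2) f_def by simp
  then obtain ha where ha: "ha \<in> Hom C A J" "j \<cdot> ha = a" using j'(4)[OF a(2)] by blast
  then have aj: "factors_through a j" using factors_throughI j'(1) by blast
  have "(d \<cdot> c) \<cdot> b = zero B (Cod C d)"
    using Comp_assoc[OF b(2) c'(1) d'(1)] c'(2) comp_zero_right[OF d'(1) HomD(4)[OF b(2)]] by simp
  then obtain hb where hb: "hb \<in> Hom C B J" "j \<cdot> hb = b" using j'(4)[OF b(2)] by blast
  then have bj: "factors_through b j" using factors_throughI j'(1) by blast
  have lub: "factors_through j u"
    if u: "monic C u" "u \<in> Hom C D X" "factors_through a u" "factors_through b u" for D u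
  proof -
    obtain v where v: "v \<in> Hom C A D" "u \<cdot> v = a" using factors_throughE[OF u(3) a(2) u(2)] .
    obtain w where w: "w \<in> Hom C B D" "u \<cdot> w = b" using factors_throughE[OF u(4) b(2) u(2)] .
    obtain t where t: "is_cokernel C u t" using ex_cokernel HomD(1)[OF u(2)] by blast
    note t' = cokernel_props[OF t u(2)]
    have t0: "t \<cdot> (u \<cdot> x) = zero E (Cod C t)" if "x \<in> Hom C E D" for x E
      using Comp_assoc[OF that u(2) t'(1)] t'(2) comp_zero_left[OF that HomD(5)[OF t'(1)]] by simp
    obtain y where y: "y \<in> Hom C Q (Cod C t)" "y \<cdot> c = t"
      using c'(4)[OF t'(1)] t0[OF w(1)] w(2) by auto
    have "y \<cdot> f = zero A (Cod C t)"
      unfolding f_def using Comp_assoc[OF a(2) c'(1) y(1)] y(2) t0[OF v(1)] v(2) by simp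
    then obtain z where z: "z \<in> Hom C (Cod C d) (Cod C t)" "z \<cdot> d = y" using d'(4)[OF y(1)] by blast
    have "t \<cdot> j = (z \<cdot> d \<cdot> c) \<cdot> j" using Comp_assoc[OF c'(1) d'(1) z(1)] z y by simp
    also have "\<dots> = zero J (Cod C t)"
      using Comp_assoc[OF j'(1) dc z(1)] j'(2) comp_zero_right[OF z(1) HomD(4)[OF j'(1)]] by simp
    finally obtain x where "x \<in> Hom C J D" "u \<cdot> x = j"
      using kernel_factor[OF monic_kernel_of_cokernel[OF u(1,2) t] t'(1) j'(1)] HomD(2)[OF u(2)] by auto
    then show ?thesis using factors_throughI u(2) by blast
  qed
  \<comment> \<open>The images \<open>i\<close> of \<open>f\<close> and \<open>i2\<close> of \<open>g\<close> are compared through the minimality of each.\<close>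
  obtain i where i: "is_kernel C d i" using ex_kernel HomD(1)[OF d'(1)] by blast
  define N where "N = Dom C i"
  note i' = kernel_props[OF i d'(1), folded N_def]
  obtain e where e: "e \<in> Hom C A N" "i \<cdot> e = f" "epic C e" "is_cokernel C k e"
    using image_factorization[OF f k d i] N_def by blast
  define g where "g = c \<cdot> j"
  have g: "g \<in> Hom C J Q" unfolding g_def using Comp_Hom[OF j'(1) c'(1)] .
  have hbm: "monic C hb" using monic_first_factor[OF _ hb(1) j'(1)] hb b by simp
  have hbk: "is_kernel C g hb"
  proof (rule kernelI[OF g hb(1) _ hbm])
    show "g \<cdot> hb = zero B Q" unfolding g_def using Comp_assoc[OF hb(1) j'(1) c'(1)] hb c'(2) by simp
    fix D x assume x: "x \<in> Hom C D J" "g \<cdot> x = zero D Q"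
    have "c \<cdot> (j \<cdot> x) = zero D Q" using Comp_assoc[OF x(1) j'(1) c'(1)] x g_def by simp
    then obtain y where y: "y \<in> Hom C D B" "b \<cdot> y = j \<cdot> x"
      using kernel_factor[OF bk c'(1) Comp_Hom[OF x(1) j'(1)]] Bd by auto
    have "j \<cdot> (hb \<cdot> y) = j \<cdot> x" using Comp_assoc[OF y(1) hb(1) j'(1)] hb y by simp
    then show "\<exists>y\<in>Hom C D B. hb \<cdot> y = x"
      using monicD[OF j'(3,1) Comp_Hom[OF y(1) hb(1)] x(1)] y by blast
  qed
  obtain d2 where d2: "is_cokernel C g d2" using ex_cokernel HomD(1)[OF g] by blast
  note d2' = cokernel_props[OF d2 g]
  obtain i2 where i2: "is_kernel C d2 i2" using ex_kernel HomD(1)[OF d2'(1)] by blast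
  define N2 where "N2 = Dom C i2"
  note i2' = kernel_props[OF i2 d2'(1), folded N2_def]
  obtain e2 where e2: "e2 \<in> Hom C J N2" "i2 \<cdot> e2 = g" "epic C e2" "is_cokernel C hb e2"
    using image_factorization[OF g hbk d2 i2] N2_def by blast
  have "d \<cdot> g = zero J (Cod C d)" unfolding g_def using Comp_assoc[OF j'(1) c'(1) d'(1)] j'(2) by simp
  then obtain w where w: "w \<in> Hom C J N" "i \<cdot> w = g" using i'(4)[OF g] by blast
  obtain r where r: "r \<in> Hom C N2 N" "i \<cdot> r = i2"
    using kernel_of_cokernel_least[OF g d2 i2 i'(3,1) w] N2_def by blast
  have "i2 \<cdot> (e2 \<cdot> ha) = f"
    unfolding f_def using Comp_assoc[OF ha(1) e2(1) i2'(1)] Comp_assoc[OF ha(1) j'(1) c'(1)] e2 ha g_def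
    by simp
  then obtain s where s: "s \<in> Hom C N N2" "i2 \<cdot> s = i"
    using kernel_of_cokernel_least[OF f d i i2'(3,1) Comp_Hom[OF ha(1) e2(1)]] N_def by blast
  have "isomorphic C N N2" unfolding isomorphic_iff
    using r s monic_retraction_inverse[OF i'(3,1) s(1) r(1) i2'(1) s(2) r(2)]
      monic_retraction_inverse[OF i2'(3,1) r(1) s(1) i'(1) r(2) s(2)] by blast
  moreover have mi: "a \<in> monics_into C X" "b \<in> monics_into C X" "m \<in> monics_into C X" "j \<in> monics_into C X"
    using a(1) b(1) m(1) j'(3) HomD(3)[OF a(2)] HomD(3)[OF b(2)] HomD(3)[OF m(2)] HomD(3)[OF j'(1)]
    by (simp_all add: monics_into_def)
  moreover have "isomorphic C (quotient_obj C (subobject X a) (subobject X m)) N"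
    using quotient_obj_isomorphic[OF mi(3) m(2) mi(1) a(2) k'(1) _ e(4)] m_def HomD(3)[OF e(1)] by simp
  moreover have "isomorphic C (quotient_obj C (subobject X j) (subobject X b)) N2"
    using quotient_obj_isomorphic[OF mi(2) b(2) mi(4) j'(1) hb(1) hb(2) e2(4)] HomD(3)[OF e2(1)] by simp
  ultimately have iso: "isomorphic C (quotient_obj C (subobject X a) (subobject X m))
      (quotient_obj C (subobject X j) (subobject X b))"
    using isomorphic_trans isomorphic_sym by blast
  show ?thesis
    by (rule that[OF m j'(3,1) ma mb _ aj bj _ iso]) (fact glb, fact lub)
qed

definition simple_step :: "'o \<Rightarrow> 'm set \<Rightarrow> 'm set \<Rightarrow> bool" where
  "simple_step X S T \<longleftrightarrow> S \<in> subobjects C X \<and> T \<in> subobjects C X \<and> sub_le C S T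
    \<and> simple_object C (quotient_obj C T S)"

text \<open>Labels must coincide for isomorphic quotients, and \<open>quotient_obj\<close> is unique only up to
  isomorphism.\<close>

definition iso_class :: "'o \<Rightarrow> 'o set" where
  "iso_class A = {B. isomorphic C A B}"

lemma iso_class_eq_iff:
  "A \<in> Obj C \<Longrightarrow> B \<in> Obj C \<Longrightarrow> iso_class A = iso_class B \<longleftrightarrow> isomorphic C A B"
  unfolding iso_class_def using isomorphic_refl isomorphic_sym isomorphic_trans by blast

lemma simple_step_monics:
  assumes "simple_step X S T" "S = subobject X m" "T = subobject X m'"
    and m: "m \<in> monics_into C X" and m': "m' \<in> monics_into C X"
  obtains h q where "h \<in> Hom C (Dom C m) (Dom C m')" "m' \<cdot> h = m" "is_cokernel C h q"
    "simple_object C (Cod C q)"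
proof -
  have H: "m \<in> Hom C (Dom C m) X" "m' \<in> Hom C (Dom C m') X" using m m' by (auto simp: monics_into_iff)
  have "factors_through m m'" using assms sub_le_subobject unfolding simple_step_def by blast
  then obtain h where h: "h \<in> Hom C (Dom C m) (Dom C m')" "m' \<cdot> h = m" using factors_throughE[OF _ H] by blast
  obtain q where q: "is_cokernel C h q" using ex_cokernel HomD(1)[OF h(1)] by blast
  have "simple_object C (Cod C q)"
    using simple_object_isomorphic[OF quotient_obj_isomorphic[OF m H(1) m' H(2) h q]] assms(1-3)
    unfolding simple_step_def by blast
  then show ?thesis using that h q by blast
qed

lemma sub_le_antisym:
  "S \<in> subobjects C X \<Longrightarrow> T \<in> subobjects C X \<Longrightarrow> sub_le C S T \<Longrightarrow> sub_le C T S \<Longrightarrow> S = T"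
  by (elim subobjectsE) (simp add: sub_le_subobject subobject_eq_iff)

lemma meet_join_subobjects:
  assumes "S \<in> subobjects C X" "T \<in> subobjects C X"
  obtains M J where "M \<in> subobjects C X" "sub_le C M S" "sub_le C M T"
    "\<And>U. U \<in> subobjects C X \<Longrightarrow> sub_le C U S \<Longrightarrow> sub_le C U T \<Longrightarrow> sub_le C U M"
    "J \<in> subobjects C X" "sub_le C S J" "sub_le C T J"
    "\<And>U. U \<in> subobjects C X \<Longrightarrow> sub_le C S U \<Longrightarrow> sub_le C T U \<Longrightarrow> sub_le C J U"
    "isomorphic C (quotient_obj C S M) (quotient_obj C J T)"
proof -
  obtain a where a: "a \<in> monics_into C X" "S = subobject X a" using assms subobjectsE by blast
  obtain b where b: "b \<in> monics_into C X" "T = subobject X b" using assms subobjectsE by blast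
  have ab: "monic C a" "a \<in> Hom C (Dom C a) X" "monic C b" "b \<in> Hom C (Dom C b) X"
    using a b by (auto simp: monics_into_iff)
  obtain M m J j where mj: "monic C m" "m \<in> Hom C M X" "monic C j" "j \<in> Hom C J X"
    and 1: "factors_through m a" "factors_through m b"
    "\<And>D u. u \<in> Hom C D X \<Longrightarrow> factors_through u a \<Longrightarrow> factors_through u b \<Longrightarrow> factors_through u m"
    "factors_through a j" "factors_through b j"
    "\<And>D u. monic C u \<Longrightarrow> u \<in> Hom C D X \<Longrightarrow> factors_through a u \<Longrightarrow> factors_through b u
      \<Longrightarrow> factors_through j u"
    and iso: "isomorphic C (quotient_obj C (subobject X a) (subobject X m))
      (quotient_obj C (subobject X j) (subobject X b))"
    by (rule second_isomorphism[OF ab], rule that)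
  have mj': "m \<in> monics_into C X" "j \<in> monics_into C X"
    using mj(1,3) HomD(3)[OF mj(2)] HomD(3)[OF mj(4)] by (simp_all add: monics_into_def)
  show ?thesis
  proof (rule that[of "subobject X m" "subobject X j"])
    fix U assume U: "U \<in> subobjects C X"
    then obtain u where u: "u \<in> monics_into C X" "U = subobject X u" using subobjectsE by blast
    then have uH: "monic C u" "u \<in> Hom C (Dom C u) X" by (auto simp: monics_into_iff)
    show "sub_le C U (subobject X m)" if "sub_le C U S" "sub_le C U T"
      using that 1(3)[OF uH(2)] a b u mj' by (simp add: sub_le_subobject)
    show "sub_le C (subobject X j) U" if "sub_le C S U" "sub_le C T U"
      using that 1(6)[OF uH] a b u mj' by (simp add: sub_le_subobject)
  qed (use 1 a b mj' iso in \<open>simp_all add: sub_le_subobject subobject_in\<close>)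
qed

text \<open>Meets and joins are unique, so the second isomorphism theorem holds for every meet and join and not
  only for the ones constructed above.\<close>

theorem subobject_lattice:
  assumes X: "X \<in> Obj C"
  shows "labelled_lattice (subobjects C X) (sub_le C) (simple_step X)
    (\<lambda>S T. iso_class (quotient_obj C T S)) (zero_sub C X) (whole_sub C X)"
proof
  show "sub_le C S S" if "S \<in> subobjects C X" for S
    using that by (elim subobjectsE) (auto simp: sub_le_subobject monics_into_iff intro: factors_through_refl)
  show "S = T" if "S \<in> subobjects C X" "T \<in> subobjects C X" "sub_le C S T" "sub_le C T S" for S T
    using sub_le_antisym that .
  show "sub_le C S U" if "S \<in> subobjects C X" "T \<in> subobjects C X" "U \<in> subobjects C X"
    "sub_le C S T" "sub_le C T U" for S T U
    using that by (elim subobjectsE)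
      (auto simp: sub_le_subobject monics_into_iff intro: factors_through_trans)
  obtain Z z where Z: "zero_object C Z" "z \<in> Hom C Z X" using ex_zero_monic[OF X] .
  note zs = zero_sub_eq[OF Z]
  show "zero_sub C X \<in> subobjects C X" using zs subobject_in by simp
  show "sub_le C (zero_sub C X) S" if S: "S \<in> subobjects C X" for S
  proof -
    obtain m where m: "m \<in> monics_into C X" "S = subobject X m" using S subobjectsE by blast
    then have mH: "m \<in> Hom C (Dom C m) X" by (simp add: monics_into_iff)
    have z0: "zero Z (Dom C m) \<in> Hom C Z (Dom C m)" using zero_Hom HomD(4) Z(2) mH by blast
    then have "m \<cdot> zero Z (Dom C m) = z" using Hom_from_zero[OF Z(1)] Comp_Hom[OF z0 mH] Z(2) by metis
    then show ?thesis using factors_throughI[OF z0 mH] m zs by (simp add: sub_le_subobject)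
  qed
  show "whole_sub C X \<in> subobjects C X"
    using whole_sub_eq subobject_in Id_monics_into X by simp
  show "sub_le C S (whole_sub C X)" if S: "S \<in> subobjects C X" for S
  proof -
    obtain m where m: "m \<in> monics_into C X" "S = subobject X m" using S subobjectsE by blast
    then have mH: "m \<in> Hom C (Dom C m) X" by (simp add: monics_into_iff)
    show ?thesis
      using factors_throughI[OF mH Id_Hom[OF X] Comp_Id_left[OF mH]] m Id_monics_into[OF X]
      by (simp add: sub_le_subobject whole_sub_eq)
  qed
  show "\<exists>M\<in>subobjects C X. sub_le C M S \<and> sub_le C M T
      \<and> (\<forall>U\<in>subobjects C X. sub_le C U S \<and> sub_le C U T \<longrightarrow> sub_le C U M)"
    if "S \<in> subobjects C X" "T \<in> subobjects C X" for S T
    by (rule meet_join_subobjects[OF that]) blast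
  show "\<exists>J\<in>subobjects C X. sub_le C S J \<and> sub_le C T J
      \<and> (\<forall>U\<in>subobjects C X. sub_le C S U \<and> sub_le C T U \<longrightarrow> sub_le C J U)"
    if "S \<in> subobjects C X" "T \<in> subobjects C X" for S T
    by (rule meet_join_subobjects[OF that]) blast
  show "S \<in> subobjects C X \<and> T \<in> subobjects C X \<and> sub_le C S T \<and> S \<noteq> T"
    if st: "simple_step X S T" for S T
  proof -
    have ST: "S \<in> subobjects C X" "T \<in> subobjects C X" "sub_le C S T" using st by (auto simp: simple_step_def)
    obtain m where m: "m \<in> monics_into C X" "S = subobject X m" using ST subobjectsE by blast
    obtain m' where m': "m' \<in> monics_into C X" "T = subobject X m'" using ST subobjectsE by blast
    obtain h q where "h \<in> Hom C (Dom C m) (Dom C m')" "m' \<cdot> h = m" "is_cokernel C h q"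
      "simple_object C (Cod C q)" using simple_step_monics[OF st m(2) m'(2) m(1) m'(1)] .
    then have "\<not> factors_through m' m" using simple_quotient_strict m m' unfolding monics_into_iff by blast
    then show ?thesis using ST m m' by (auto simp: subobject_eq_iff)
  qed
  show "U = S \<or> U = T"
    if st: "simple_step X S T" and U: "U \<in> subobjects C X" "sub_le C S U" "sub_le C U T" for S T U
  proof -
    have ST: "S \<in> subobjects C X" "T \<in> subobjects C X" "sub_le C S T" using st by (auto simp: simple_step_def)
    obtain m where m: "m \<in> monics_into C X" "S = subobject X m" using ST subobjectsE by blast
    obtain m' where m': "m' \<in> monics_into C X" "T = subobject X m'" using ST subobjectsE by blast
    obtain u where u: "u \<in> monics_into C X" "U = subobject X u" using U subobjectsE by blast
    have mono: "monic C m" "m \<in> Hom C (Dom C m) X" "monic C m'" "m' \<in> Hom C (Dom C m') X"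
      "monic C u" "u \<in> Hom C (Dom C u) X" using m m' u by (auto simp: monics_into_iff)
    obtain h q where hq: "h \<in> Hom C (Dom C m) (Dom C m')" "m' \<cdot> h = m" "is_cokernel C h q"
      "simple_object C (Cod C q)" using simple_step_monics[OF st m(2) m'(2) m(1) m'(1)] .
    have le: "factors_through m u" "factors_through u m'" using U m m' u by (auto simp: sub_le_subobject)
    from simple_quotient_nothing_between[OF mono hq le] show ?thesis
      using le m m' u by (auto simp: subobject_eq_iff)
  qed
  fix S T M J
  assume ST: "S \<in> subobjects C X" "T \<in> subobjects C X" and M: "M \<in> subobjects C X" and J: "J \<in> subobjects C X"
    and M': "sub_le C M S" "sub_le C M T"
      "\<And>U. U \<in> subobjects C X \<Longrightarrow> sub_le C U S \<Longrightarrow> sub_le C U T \<Longrightarrow> sub_le C U M"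
    and J': "sub_le C S J" "sub_le C T J"
      "\<And>U. U \<in> subobjects C X \<Longrightarrow> sub_le C S U \<Longrightarrow> sub_le C T U \<Longrightarrow> sub_le C J U"
  obtain M1 J1 where M1: "M1 \<in> subobjects C X" "sub_le C M1 S" "sub_le C M1 T"
      "\<And>U. U \<in> subobjects C X \<Longrightarrow> sub_le C U S \<Longrightarrow> sub_le C U T \<Longrightarrow> sub_le C U M1"
    and J1: "J1 \<in> subobjects C X" "sub_le C S J1" "sub_le C T J1"
      "\<And>U. U \<in> subobjects C X \<Longrightarrow> sub_le C S U \<Longrightarrow> sub_le C T U \<Longrightarrow> sub_le C J1 U"
    and iso1: "isomorphic C (quotient_obj C S M1) (quotient_obj C J1 T)"
    by (rule meet_join_subobjects[OF ST], rule that)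
  have "M = M1" by (rule sub_le_antisym[OF M M1(1)]) (use M M' M1 in auto)
  moreover have "J = J1" by (rule sub_le_antisym[OF J J1(1)]) (use J J' J1 in auto)
  ultimately have iso: "isomorphic C (quotient_obj C S M) (quotient_obj C J T)" using iso1 by simp
  then have "simple_object C (quotient_obj C S M) \<longleftrightarrow> simple_object C (quotient_obj C J T)"
    using simple_object_isomorphic isomorphic_sym by blast
  then show "simple_step X M S = simple_step X T J \<and>
      iso_class (quotient_obj C S M) = iso_class (quotient_obj C J T)"
    unfolding simple_step_def
    using ST M J M' J' iso iso_class_eq_iff isomorphic_Obj by blast
qed

end

section \<open>Subobjects of a subobject\<close>

context abelian_category
begin

text \<open>For a monic \<open>m\<close> from \<open>Y\<close> to \<open>X\<close>, the map \<open>push X m\<close> embeds the subobjects of \<open>Y\<close> into those of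
  \<open>X\<close> that lie below \<open>m\<close>. Taking the equivalence class of the image avoids a choice of
  representative.\<close>

definition push :: "'o \<Rightarrow> 'm \<Rightarrow> 'm set \<Rightarrow> 'm set" where
  "push X m R = sub_equiv C X `` ((\<lambda>r. m \<cdot> r) ` R)"

context
  fixes m X Y
  assumes m: "monic C m" and mH: "m \<in> Hom C Y X"
begin

lemma comp_monics_into:
  assumes "r \<in> monics_into C Y"
  shows "m \<cdot> r \<in> monics_into C X" "m \<cdot> r \<in> Hom C (Dom C r) X" "r \<in> Hom C (Dom C r) Y"
proof -
  have r: "monic C r" "r \<in> Hom C (Dom C r) Y" using assms by (auto simp: monics_into_iff)
  show c: "m \<cdot> r \<in> Hom C (Dom C r) X" using Comp_Hom[OF r(2) mH] .
  show "m \<cdot> r \<in> monics_into C X"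
    using monic_comp[OF r m mH] HomD(3)[OF c] by (simp add: monics_into_def)
  show "r \<in> Hom C (Dom C r) Y" by fact
qed

lemma factors_through_comp_iff:
  assumes r: "r \<in> monics_into C Y" and s: "s \<in> monics_into C Y"
  shows "factors_through (m \<cdot> r) (m \<cdot> s) \<longleftrightarrow> factors_through r s"
proof
  note r' = comp_monics_into[OF r] and s' = comp_monics_into[OF s]
  assume "factors_through (m \<cdot> r) (m \<cdot> s)"
  then obtain h where h: "h \<in> Hom C (Dom C r) (Dom C s)" "(m \<cdot> s) \<cdot> h = m \<cdot> r"
    using factors_throughE[OF _ r'(2) s'(2)] by blast
  have "s \<cdot> h = r"
    using monicD[OF m mH Comp_Hom[OF h(1) s'(3)] r'(3)] Comp_assoc[OF h(1) s'(3) mH] h by simp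
  then show "factors_through r s" using factors_throughI[OF h(1) s'(3)] by blast
next
  note r' = comp_monics_into[OF r] and s' = comp_monics_into[OF s]
  assume "factors_through r s"
  then obtain h where h: "h \<in> Hom C (Dom C r) (Dom C s)" "s \<cdot> h = r"
    using factors_throughE[OF _ r'(3) s'(3)] by blast
  then show "factors_through (m \<cdot> r) (m \<cdot> s)"
    using factors_throughI[OF h(1) s'(2)] Comp_assoc[OF h(1) s'(3) mH] by simp
qed

lemma push_subobject:
  assumes r: "r \<in> monics_into C Y"
  shows "push X m (subobject Y r) = subobject X (m \<cdot> r)"
proof -
  have same: "subobject X (m \<cdot> s) = subobject X (m \<cdot> r)" if "s \<in> subobject Y r" for s
  proof -
    have s: "s \<in> monics_into C Y" "factors_through r s" "factors_through s r"
      using that by (auto simp: mem_subobject_iff sub_equiv_iff)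
    then show ?thesis
      using subobject_eq_iff[OF comp_monics_into(1)[OF s(1)] comp_monics_into(1)[OF r]]
        factors_through_comp_iff r by blast
  qed
  have "push X m (subobject Y r) = (\<Union>s\<in>subobject Y r. subobject X (m \<cdot> s))"
    unfolding push_def subobject_def[of X] by blast
  also have "\<dots> = subobject X (m \<cdot> r)"
    by (rule SUP_eq_const) (use mem_subobject_self[OF r] same in blast)+
  finally show ?thesis .
qed

lemma push_in: "R \<in> subobjects C Y \<Longrightarrow> push X m R \<in> subobjects C X"
  by (elim subobjectsE) (simp add: push_subobject subobject_in comp_monics_into)

lemma sub_le_push:
  "R \<in> subobjects C Y \<Longrightarrow> S \<in> subobjects C Y \<Longrightarrow> sub_le C (push X m R) (push X m S) \<longleftrightarrow> sub_le C R S"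
  by (elim subobjectsE)
    (simp add: push_subobject sub_le_subobject comp_monics_into factors_through_comp_iff)

text \<open>The inclusion \<open>h\<close> of \<open>R\<close> into \<open>S\<close> is the same arrow before and after composing with \<open>m\<close>, so
  both quotients are its cokernel.\<close>

lemma quotient_push:
  assumes R: "R \<in> subobjects C Y" and S: "S \<in> subobjects C Y" and le: "sub_le C R S"
  shows "isomorphic C (quotient_obj C (push X m S) (push X m R)) (quotient_obj C S R)"
proof -
  obtain r where r: "r \<in> monics_into C Y" "R = subobject Y r" using R subobjectsE by blast
  obtain s where s: "s \<in> monics_into C Y" "S = subobject Y s" using S subobjectsE by blast
  note r' = comp_monics_into[OF r(1)] and s' = comp_monics_into[OF s(1)]
  obtain h where h: "h \<in> Hom C (Dom C r) (Dom C s)" "s \<cdot> h = r"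
    using le r s factors_throughE[OF _ r'(3) s'(3)] by (auto simp: sub_le_subobject)
  have h': "(m \<cdot> s) \<cdot> h = m \<cdot> r" using Comp_assoc[OF h(1) s'(3) mH] h by simp
  obtain q where q: "is_cokernel C h q" using ex_cokernel HomD(1)[OF h(1)] by blast
  have "isomorphic C (quotient_obj C S R) (Cod C q)"
    using quotient_obj_isomorphic[OF r(1) r'(3) s(1) s'(3) h q] r s by simp
  moreover have "isomorphic C (quotient_obj C (push X m S) (push X m R)) (Cod C q)"
    using quotient_obj_isomorphic[OF r'(1,2) s'(1,2) h(1) h' q] r s by (simp add: push_subobject)
  ultimately show ?thesis using isomorphic_trans isomorphic_sym by blast
qed

lemma simple_step_push:
  assumes R: "R \<in> subobjects C Y" and S: "S \<in> subobjects C Y"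
  shows "simple_step X (push X m R) (push X m S) \<longleftrightarrow> simple_step Y R S"
  unfolding simple_step_def
  using R S push_in sub_le_push quotient_push simple_object_isomorphic isomorphic_sym by blast

lemma push_zero: "push X m (zero_sub C Y) = zero_sub C X"
proof -
  obtain Z z where Z: "zero_object C Z" "z \<in> Hom C Z Y" using ex_zero_monic[OF HomD(4)[OF mH]] .
  have "m \<cdot> z \<in> Hom C Z X" using Comp_Hom[OF Z(2) mH] .
  then show ?thesis using zero_sub_eq Z push_subobject by metis
qed

lemma push_whole: "push X m (whole_sub C Y) = subobject X m"
  using push_subobject[OF Id_monics_into] HomD(4)[OF mH] Comp_Id_right[OF mH] whole_sub_eq by simp

lemma push_surj:
  assumes T: "T \<in> subobjects C X" and le: "sub_le C T (subobject X m)"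
  shows "\<exists>R\<in>subobjects C Y. push X m R = T"
proof -
  obtain t where t: "t \<in> monics_into C X" "T = subobject X t" using T subobjectsE by blast
  have tH: "monic C t" "t \<in> Hom C (Dom C t) X" using t by (auto simp: monics_into_iff)
  have mi: "m \<in> monics_into C X" using m HomD(3)[OF mH] by (simp add: monics_into_def)
  obtain h where h: "h \<in> Hom C (Dom C t) Y" "m \<cdot> h = t"
    using le t mi factors_throughE[OF _ tH(2) mH] by (auto simp: sub_le_subobject)
  have "monic C h" using monic_first_factor[OF _ h(1) mH] h tH by simp
  then have "h \<in> monics_into C Y" using HomD(3)[OF h(1)] by (simp add: monics_into_def)
  then show ?thesis using push_subobject h t subobject_in by metis
qed

end

section \<open>Composition series and labellings\<close>

lemma composition_series_iff_chain:
  assumes X: "X \<in> Obj C"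
  shows "composition_series C X n A \<longleftrightarrow> A 0 = zero_sub C X \<and> A n = whole_sub C X
    \<and> labelled_lattice.chain (simple_step X) n A"
proof -
  interpret L: labelled_lattice "subobjects C X" "sub_le C" "simple_step X"
    "\<lambda>S T. iso_class (quotient_obj C T S)" "zero_sub C X" "whole_sub C X"
    using subobject_lattice[OF X] .
  show ?thesis
  proof
    assume c: "composition_series C X n A"
    have "simple_step X (A k) (A (Suc k))" if "k < n" for k
    proof -
      have "Suc k \<in> {1..n}" using that by simp
      then show ?thesis using c that unfolding composition_series_def simple_step_def factor_def
        by (metis diff_Suc_1 less_imp_le_nat Suc_leI)
    qed
    then show "A 0 = zero_sub C X \<and> A n = whole_sub C X \<and> L.chain n A"
      using c unfolding composition_series_def L.chain_def by blast
  next
    assume c: "A 0 = zero_sub C X \<and> A n = whole_sub C X \<and> L.chain n A"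
    have st: "simple_step X (A (k - 1)) (A k)" if "k \<in> {1..n}" for k
      using that c unfolding L.chain_def by (cases k) auto
    have "A k \<in> subobjects C X" if "k \<le> n" for k
    proof (cases k)
      case 0
      then show ?thesis using c L.bt(1) by simp
    next
      case (Suc l)
      then show ?thesis using st[of k] that unfolding simple_step_def by simp
    qed
    then show "composition_series C X n A"
      unfolding composition_series_def factor_def using X c st by (auto simp: simple_step_def)
  qed
qed

lemma composition_series_factor_Obj:
  "composition_series C X n A \<Longrightarrow> k \<in> {1..n} \<Longrightarrow> factor C A k \<in> Obj C"
  unfolding composition_series_def simple_object_def by blast

text \<open>The existence of a bijection is replaced by an equation of multisets. From the equation, the map
  from positions to isomorphism classes is onto the classes of \<open>F\<close>, and by counting it is
  injective; \<open>\<phi>\<close> is its inverse.\<close>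

lemma ex_factor_labelling_iff:
  assumes A: "composition_series C Y n A" and J: "finite J" and F: "\<And>i. i \<in> J \<Longrightarrow> F i \<in> Obj C"
    and inj: "inj_on (\<lambda>i. iso_class (F i)) J"
  shows "(\<exists>\<phi>. factor_labelling C J F n A \<phi>) \<longleftrightarrow>
    image_mset (\<lambda>k. iso_class (factor C A (Suc k))) (mset_set {..<n})
      = mset_set ((\<lambda>i. iso_class (F i)) ` J)"
proof -
  \<comment> \<open>Positions run from \<open>1\<close> to \<open>n\<close>, whereas chains index their steps from \<open>0\<close>.\<close>
  define g where "g k = iso_class (factor C A k)" for k
  define f where "f = (\<lambda>i. iso_class (F i))"
  have "{1..n} = Suc ` {..<n}" by (simp add: image_Suc_lessThan)
  then have "mset_set {1..n} = image_mset Suc (mset_set {..<n})"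
    by (simp add: image_mset_mset_set)
  then have shift: "image_mset (\<lambda>k. iso_class (factor C A (Suc k))) (mset_set {..<n})
      = image_mset g (mset_set {1..n})"
    by (simp add: g_def image_mset.compositionality comp_def)
  have iso: "isomorphic C (F i) (factor C A k) \<longleftrightarrow> f i = g k" if "i \<in> J" "k \<in> {1..n}" for i k
    unfolding f_def g_def
    using iso_class_eq_iff[OF F[OF that(1)] composition_series_factor_Obj[OF A that(2)]] by blast
  have "(\<exists>\<phi>. factor_labelling C J F n A \<phi>) \<longleftrightarrow> image_mset g (mset_set {1..n}) = mset_set (f ` J)"
  proof
    assume "\<exists>\<phi>. factor_labelling C J F n A \<phi>"
    then obtain \<phi> where \<phi>: "bij_betw \<phi> J {1..n}" "\<forall>i\<in>J. isomorphic C (F i) (factor C A (\<phi> i))"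
      unfolding factor_labelling_def by blast
    have "mset_set {1..n} = image_mset \<phi> (mset_set J)"
      using \<phi>(1) image_mset_mset_set unfolding bij_betw_def by metis
    then have "image_mset g (mset_set {1..n}) = image_mset (\<lambda>i. g (\<phi> i)) (mset_set J)"
      by (simp add: image_mset.compositionality comp_def)
    also have "\<dots> = image_mset f (mset_set J)"
    proof (rule image_mset_cong)
      fix i assume "i \<in># mset_set J"
      then have i: "i \<in> J" using J by simp
      moreover have "\<phi> i \<in> {1..n}" using \<phi>(1) i by (auto simp: bij_betw_def)
      ultimately have "f i = g (\<phi> i)" using iso \<phi>(2) by blast
      then show "g (\<phi> i) = f i" ..
    qed
    also have "\<dots> = mset_set (f ` J)" using inj by (intro image_mset_mset_set) (simp add: f_def)
    finally show "image_mset g (mset_set {1..n}) = mset_set (f ` J)" .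
  next
    assume eq: "image_mset g (mset_set {1..n}) = mset_set (f ` J)"
    have im: "g ` {1..n} = f ` J" using arg_cong[OF eq, of set_mset] J by simp
    have "card (g ` {1..n}) = card {1..n}" using arg_cong[OF eq, of size] im by simp
    then have "inj_on g {1..n}" by (intro eq_card_imp_inj_on) auto
    then have g: "bij_betw g {1..n} (f ` J)" using im by (simp add: bij_betw_def)
    have f: "bij_betw f J (f ` J)" using inj by (simp add: bij_betw_def f_def)
    define \<phi> where "\<phi> = inv_into {1..n} g \<circ> f"
    have b: "bij_betw \<phi> J {1..n}"
      unfolding \<phi>_def using bij_betw_trans[OF f bij_betw_inv_into[OF g]] .
    have "f i = g (\<phi> i)" if "i \<in> J" for i
      unfolding \<phi>_def using that im by (metis comp_apply f_inv_into_f imageI)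
    then have "factor_labelling C J F n A \<phi>"
      unfolding factor_labelling_def using b iso bij_betw_apply[OF b] by blast
    then show "\<exists>\<phi>. factor_labelling C J F n A \<phi>" by blast
  qed
  then show ?thesis unfolding shift f_def .
qed

end

section \<open>Objects with nonisomorphic simple factors\<close>

locale multiplicity_free_object = abelian_category C for C :: "('o, 'm) add_cat" +
  fixes X :: 'o and I :: "'i set" and F :: "'i \<Rightarrow> 'o"
  assumes X: "X \<in> Obj C" and nonisomorphic: "nonisomorphic_simple_factors C X I F"
begin

text \<open>The same prefix is used below for the stronger locale, which needs the facts about chains that are
  proved from this interpretation.\<close>

sublocale sub: labelled_lattice "subobjects C X" "sub_le C" "simple_step X"
  "\<lambda>S T. iso_class (quotient_obj C T S)" "zero_sub C X" "whole_sub C X"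
  using subobject_lattice[OF X] .

abbreviation cl :: "'i \<Rightarrow> 'o set" where "cl i \<equiv> iso_class (F i)"

lemma indexing:
  shows finite_I: "finite I" and F_Obj: "i \<in> I \<Longrightarrow> F i \<in> Obj C" and inj_cl: "inj_on cl I"
    and content_whole: "sub.content (whole_sub C X) = mset_set (cl ` I)"
    and ex_sub_series: "\<exists>M. sub.series (zero_sub C X) M (whole_sub C X)"
proof -
  obtain n A \<phi> where A: "composition_series C X n A"
    and non: "\<And>k l. 1 \<le> k \<Longrightarrow> k < l \<Longrightarrow> l \<le> n \<Longrightarrow> \<not> isomorphic C (factor C A k) (factor C A l)"
    and lab: "factor_labelling C I F n A \<phi>"
    using nonisomorphic unfolding nonisomorphic_simple_factors_def by blast
  have \<phi>: "bij_betw \<phi> I {1..n}" and iso: "\<And>i. i \<in> I \<Longrightarrow> isomorphic C (F i) (factor C A (\<phi> i))"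
    using lab unfolding factor_labelling_def by auto
  show fin: "finite I" using bij_betw_finite[OF \<phi>] by simp
  show Obj: "F i \<in> Obj C" if "i \<in> I" for i using iso[OF that] isomorphic_Obj by blast
  show inj: "inj_on cl I"
  proof (rule inj_onI, rule ccontr)
    fix i j assume ij: "i \<in> I" "j \<in> I" "cl i = cl j" "i \<noteq> j"
    then have "isomorphic C (F i) (F j)" using iso_class_eq_iff Obj by blast
    then have eq: "isomorphic C (factor C A (\<phi> i)) (factor C A (\<phi> j))"
      using isomorphic_trans[OF isomorphic_sym[OF iso[OF ij(1)]]] isomorphic_trans[OF _ iso[OF ij(2)]]
      by blast
    moreover have "\<phi> i \<noteq> \<phi> j" "\<phi> i \<in> {1..n}" "\<phi> j \<in> {1..n}"
      using \<phi> ij unfolding bij_betw_def inj_on_def by auto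
    ultimately show False using non[of "\<phi> i" "\<phi> j"] non[of "\<phi> j" "\<phi> i"] isomorphic_sym by force
  qed
  have c: "A 0 = zero_sub C X" "A n = whole_sub C X" "sub.chain n A"
    using A composition_series_iff_chain[OF X] by auto
  have "sub.series (zero_sub C X) (image_mset (\<lambda>k. iso_class (factor C A (Suc k))) (mset_set {..<n}))
      (whole_sub C X)"
    using sub.chain_series[of A n n] c sub.bt(1) by (simp add: factor_def)
  moreover have "image_mset (\<lambda>k. iso_class (factor C A (Suc k))) (mset_set {..<n}) = mset_set (cl ` I)"
    using ex_factor_labelling_iff[OF A fin Obj inj] lab by blast
  ultimately have s: "sub.series (zero_sub C X) (mset_set (cl ` I)) (whole_sub C X)" by simp
  then show "\<exists>M. sub.series (zero_sub C X) M (whole_sub C X)" ..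
  show "sub.content (whole_sub C X) = mset_set (cl ` I)" using sub.content_eq[OF s] .
qed

sublocale sub: multiplicity_free_lattice "subobjects C X" "sub_le C" "simple_step X"
  "\<lambda>S T. iso_class (quotient_obj C T S)" "zero_sub C X" "whole_sub C X"
  by unfold_locales (use ex_sub_series in \<open>simp_all add: content_whole count_mset_set'\<close>)

lemma labels_whole: "sub.labels (whole_sub C X) = cl ` I"
  unfolding sub.labels_def content_whole using finite_I by simp

lemma composition_series_labels:
  assumes B: "composition_series C X n B" and k: "k \<le> n"
  shows "sub.labels (B k) = (\<lambda>l. iso_class (factor C B l)) ` {1..k}"
proof -
  have c: "B 0 = zero_sub C X" "B n = whole_sub C X" "sub.chain n B"
    using B composition_series_iff_chain[OF X] by auto
  have "sub.content (B k) = image_mset (\<lambda>l. iso_class (quotient_obj C (B (Suc l)) (B l))) (mset_set {..<k})"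
    using sub.content_eq sub.chain_series[of B n k] c sub.bt(1) k by simp
  then have "sub.labels (B k) = (\<lambda>l. iso_class (factor C B (Suc l))) ` {..<k}"
    unfolding sub.labels_def by (simp add: factor_def)
  also have "\<dots> = (\<lambda>l. iso_class (factor C B l)) ` (Suc ` {..<k})" by (simp add: image_image)
  finally show ?thesis by (simp add: image_Suc_lessThan)
qed

text \<open>The factors of \<open>B k\<close> are the first \<open>k\<close> factors of the series, and \<open>i\<close> is determined by the
  isomorphism class of its factor.\<close>

lemma label_position:
  assumes B: "composition_series C X n B" and \<phi>: "factor_labelling C I F n B \<phi>"
    and k: "k \<le> n" and i: "i \<in> I"
  shows "cl i \<in> sub.labels (B k) \<longleftrightarrow> \<phi> i \<le> k"
proof -
  have b: "bij_betw \<phi> I {1..n}" and eq: "\<And>j. j \<in> I \<Longrightarrow> cl j = iso_class (factor C B (\<phi> j))"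
    using \<phi> iso_class_eq_iff isomorphic_Obj unfolding factor_labelling_def by blast+
  show ?thesis
  proof
    assume "\<phi> i \<le> k"
    moreover have "\<phi> i \<in> {1..n}" using b i by (auto simp: bij_betw_def)
    ultimately show "cl i \<in> sub.labels (B k)"
      unfolding composition_series_labels[OF B k] using eq[OF i] by auto
  next
    assume "cl i \<in> sub.labels (B k)"
    then obtain l where l: "l \<in> {1..k}" "cl i = iso_class (factor C B l)"
      unfolding composition_series_labels[OF B k] by blast
    then have "l \<in> \<phi> ` I" using b k by (auto simp: bij_betw_def)
    then obtain j where j: "j \<in> I" "l = \<phi> j" by blast
    then have "cl i = cl j" using eq[OF j(1)] l by simp
    then have "i = j" using inj_onD[OF inj_cl] i j(1) by blast
    then show "\<phi> i \<le> k" using j l by simp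
  qed
qed

lemma ex_labelling:
  assumes B: "composition_series C X n B" shows "\<exists>\<phi>. factor_labelling C I F n B \<phi>"
proof -
  have c: "B 0 = zero_sub C X" "B n = whole_sub C X" "sub.chain n B"
    using B composition_series_iff_chain[OF X] by auto
  have "sub.content (whole_sub C X) = image_mset (\<lambda>l. iso_class (factor C B (Suc l))) (mset_set {..<n})"
    using sub.content_eq sub.chain_series[of B n n] c sub.bt(1) by (simp add: factor_def)
  then show ?thesis
    using ex_factor_labelling_iff[OF B finite_I F_Obj inj_cl] content_whole by simp
qed

text \<open>A subobject \<open>S\<close> with factor \<open>j\<close> occurs as the member \<open>A p\<close> of a composition series; then
  \<open>\<phi> i \<le> \<phi> j \<le> p\<close>. Conversely, take \<open>S = B (\<phi> j)\<close>.\<close>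

theorem factor_le_iff:
  assumes i: "i \<in> I" and j: "j \<in> I"
  shows "factor_le C X I F i j \<longleftrightarrow>
    (\<forall>S\<in>subobjects C X. cl j \<in> sub.labels S \<longrightarrow> cl i \<in> sub.labels S)"
proof
  assume le: "factor_le C X I F i j"
  show "\<forall>S\<in>subobjects C X. cl j \<in> sub.labels S \<longrightarrow> cl i \<in> sub.labels S"
  proof (intro ballI impI)
    fix S assume S: "S \<in> subobjects C X" "cl j \<in> sub.labels S"
    obtain n p A where A: "p \<le> n" "A 0 = zero_sub C X" "A p = S" "A n = whole_sub C X" "sub.chain n A"
      using sub.ex_chain_through[OF S(1)] .
    then have cs: "composition_series C X n A" using composition_series_iff_chain[OF X] by blast
    obtain \<phi> where \<phi>: "factor_labelling C I F n A \<phi>" using ex_labelling[OF cs] by blast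
    have "\<phi> i \<le> \<phi> j" using le cs \<phi> unfolding factor_le_def by blast
    moreover have "\<phi> j \<le> p" using label_position[OF cs \<phi> A(1) j] S A(3) by simp
    ultimately show "cl i \<in> sub.labels S" using label_position[OF cs \<phi> A(1) i] A(3) by simp
  qed
next
  assume all: "\<forall>S\<in>subobjects C X. cl j \<in> sub.labels S \<longrightarrow> cl i \<in> sub.labels S"
  have "\<phi> i \<le> \<phi> j" if B: "composition_series C X n B" and \<phi>: "factor_labelling C I F n B \<phi>" for n B \<phi>
  proof -
    have n: "\<phi> j \<le> n" using \<phi> j unfolding factor_labelling_def bij_betw_def by auto
    then have "B (\<phi> j) \<in> subobjects C X" using B unfolding composition_series_def by blast
    then show ?thesis using all label_position[OF B \<phi> n i] label_position[OF B \<phi> n j] by simp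
  qed
  then show "factor_le C X I F i j" unfolding factor_le_def using i j by blast
qed

text \<open>Composing with \<open>m\<close> turns the series of the underlying object into a chain from \<open>0\<close> to \<open>S\<close> with
  the same factors.\<close>

lemma content_of_composition_series:
  assumes S: "S \<in> subobjects C X" and mS: "m \<in> S" and A: "composition_series C (Dom C m) n A"
  shows "sub.content S = image_mset (\<lambda>k. iso_class (factor C A (Suc k))) (mset_set {..<n})"
proof -
  let ?Y = "Dom C m"
  have m: "m \<in> monics_into C X" "S = subobject X m" using subobject_eq_mem[OF S mS] by auto
  then have mH: "monic C m" "m \<in> Hom C ?Y X" by (auto simp: monics_into_iff)
  note Y = HomD(4)[OF mH(2)]
  interpret Y: labelled_lattice "subobjects C ?Y" "sub_le C" "simple_step ?Y"
    "\<lambda>S T. iso_class (quotient_obj C T S)" "zero_sub C ?Y" "whole_sub C ?Y"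
    using subobject_lattice[OF Y] .
  have c: "A 0 = zero_sub C ?Y" "A n = whole_sub C ?Y" "Y.chain n A"
    using A composition_series_iff_chain[OF Y] by auto
  define B where "B k = push X m (A k)" for k
  have st: "simple_step ?Y (A k) (A (Suc k))" if "k < n" for k
    using c(3) that by (simp add: Y.chain_def)
  have "sub.chain n B"
    unfolding sub.chain_def B_def using simple_step_push[OF mH] st unfolding simple_step_def by blast
  then have "sub.series (B 0) (image_mset (\<lambda>k. iso_class (quotient_obj C (B (Suc k)) (B k))) (mset_set {..<n})) (B n)"
    using sub.chain_series[of B n n] push_zero[OF mH] c(1) sub.bt(1) by (simp add: B_def)
  then have "sub.content S = image_mset (\<lambda>k. iso_class (quotient_obj C (B (Suc k)) (B k))) (mset_set {..<n})"
    using sub.content_eq push_zero[OF mH] push_whole[OF mH] c(1,2) m(2) by (simp add: B_def)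
  also have "\<dots> = image_mset (\<lambda>k. iso_class (factor C A (Suc k))) (mset_set {..<n})"
  proof (rule image_mset_cong)
    fix k assume "k \<in># mset_set {..<n}"
    then have "simple_step ?Y (A k) (A (Suc k))" using st by simp
    then have "isomorphic C (quotient_obj C (B (Suc k)) (B k)) (factor C A (Suc k))"
      using quotient_push[OF mH] by (simp add: B_def factor_def simple_step_def)
    then show "iso_class (quotient_obj C (B (Suc k)) (B k)) = iso_class (factor C A (Suc k))"
      using iso_class_eq_iff isomorphic_Obj by blast
  qed
  finally show ?thesis .
qed

text \<open>Without this, \<open>sub_has_factors\<close> could hold vacuously and would not determine the factors. A chain
  from \<open>0\<close> to \<open>S\<close> in the lattice of \<open>X\<close> is pulled back along \<open>push\<close>, one step at a time.\<close>

lemma ex_composition_series_below: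
  assumes S: "S \<in> subobjects C X" and mS: "m \<in> S"
  shows "\<exists>n A. composition_series C (Dom C m) n A"
proof -
  let ?Y = "Dom C m"
  have m: "m \<in> monics_into C X" "S = subobject X m" using subobject_eq_mem[OF S mS] by auto
  then have mH: "monic C m" "m \<in> Hom C ?Y X" by (auto simp: monics_into_iff)
  note Y = HomD(4)[OF mH(2)]
  interpret Y: labelled_lattice "subobjects C ?Y" "sub_le C" "simple_step ?Y"
    "\<lambda>S T. iso_class (quotient_obj C T S)" "zero_sub C ?Y" "whole_sub C ?Y"
    using subobject_lattice[OF Y] .
  have "sub.series T M U \<Longrightarrow> R \<in> subobjects C ?Y \<Longrightarrow> push X m R = T \<Longrightarrow> U = S
      \<Longrightarrow> \<exists>N. Y.series R N (whole_sub C ?Y)" for T M U R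
  proof (induction arbitrary: R rule: sub.series.induct)
    case (series_refl T)
    have "push X m R = push X m (whole_sub C ?Y)" using series_refl push_whole[OF mH] m by simp
    then have "R = whole_sub C ?Y"
      using sub_le_push[OF mH] series_refl.prems(1) Y.tp Y.refl sub_le_antisym by metis
    then show ?case using Y.series.series_refl Y.tp(1) by blast
  next
    case (series_step T T' M U)
    have T': "T' \<in> subobjects C X" "sub_le C T' S"
      using sub.series_le[OF series_step.hyps(2)] series_step.prems by auto
    then obtain R' where R': "R' \<in> subobjects C ?Y" "push X m R' = T'" using push_surj[OF mH] m by blast
    have "simple_step ?Y R R'"
      using simple_step_push[OF mH series_step.prems(1) R'(1)] R' series_step by simp
    then show ?case using series_step.IH[OF R' series_step.prems(3)] Y.series.series_step by blast
  qed
  from this[OF sub.series_content[OF S] Y.bt(1) push_zero[OF mH]]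
  obtain N where N: "Y.series (zero_sub C ?Y) N (whole_sub C ?Y)" by auto
  obtain n A where "A 0 = zero_sub C ?Y" "A n = whole_sub C ?Y" "Y.chain n A"
    using Y.series_imp_chain[OF N] by auto
  then have "composition_series C ?Y n A" using composition_series_iff_chain[OF Y] by simp
  then show ?thesis by blast
qed

theorem sub_has_factors_iff:
  assumes S: "S \<in> subobjects C X" and J: "J \<subseteq> I"
  shows "sub_has_factors C S F J \<longleftrightarrow> sub.labels S = cl ` J"
proof -
  have fin: "finite J" using J finite_I finite_subset by blast
  have F': "\<And>i. i \<in> J \<Longrightarrow> F i \<in> Obj C" using F_Obj J by blast
  have lab: "(\<exists>\<phi>. factor_labelling C J F n A \<phi>) \<longleftrightarrow> sub.labels S = cl ` J"
    if "m \<in> S" "composition_series C (Dom C m) n A" for m n A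
  proof -
    have "(\<exists>\<phi>. factor_labelling C J F n A \<phi>) \<longleftrightarrow> sub.content S = mset_set (cl ` J)"
      using ex_factor_labelling_iff[OF that(2) fin F' inj_on_subset[OF inj_cl J]]
      unfolding content_of_composition_series[OF S that] .
    also have "\<dots> \<longleftrightarrow> sub.labels S = cl ` J"
    proof
      assume "sub.content S = mset_set (cl ` J)"
      then show "sub.labels S = cl ` J" unfolding sub.labels_def using fin by simp
    next
      assume "sub.labels S = cl ` J"
      then show "sub.content S = mset_set (cl ` J)" using sub.content_labels[OF S] by simp
    qed
    finally show ?thesis .
  qed
  obtain m where m: "m \<in> S" using S subobjectsE mem_subobject_self by blast
  show ?thesis unfolding sub_has_factors_def
    using lab ex_composition_series_below[OF S m] m by blast
qed

lemma cl_image_inj: "J \<subseteq> I \<Longrightarrow> K \<subseteq> I \<Longrightarrow> cl ` J = cl ` K \<Longrightarrow> J = K"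
  using inj_on_image_eq_iff[OF inj_cl] by blast

lemma ex1_subobject_of_s_set:
  assumes J: "s_set C X I F J"
  shows "\<exists>!S. S \<in> subobjects C X \<and> sub_has_factors C S F J"
proof -
  have JI: "J \<subseteq> I" using J by (simp add: s_set_def)
  have "\<exists>S\<in>subobjects C X. sub.labels S = cl ` J"
  proof (rule sub.ex_labels_downset)
    show "cl ` J \<subseteq> sub.labels (whole_sub C X)" using JI labels_whole by blast
    fix x y assume y: "y \<in> cl ` J"
      and xy: "\<And>S. S \<in> subobjects C X \<Longrightarrow> y \<in> sub.labels S \<Longrightarrow> x \<in> sub.labels S"
    obtain j where j: "j \<in> J" "y = cl j" using y by blast
    have "x \<in> sub.labels (whole_sub C X)" using xy[OF sub.tp(1)] y JI labels_whole by blast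
    then obtain i where i: "i \<in> I" "x = cl i" using labels_whole by blast
    have "factor_le C X I F i j" using factor_le_iff i j JI xy by blast
    then show "x \<in> cl ` J" using J i j unfolding s_set_def by blast
  qed
  then show ?thesis using sub_has_factors_iff JI sub.labels_inj by metis
qed

lemma s_set_of_subobject:
  assumes S: "S \<in> subobjects C X"
  shows "\<exists>J. s_set C X I F J \<and> sub_has_factors C S F J"
proof -
  define J where "J = {i \<in> I. cl i \<in> sub.labels S}"
  have "sub.labels S \<subseteq> cl ` I" using sub.labels_mono[OF S sub.tp(1) sub.tp(2)[OF S]] labels_whole by simp
  then have "sub.labels S = cl ` J" unfolding J_def by blast
  moreover have "s_set C X I F J" unfolding s_set_def J_def using factor_le_iff S by blast
  moreover have "J \<subseteq> I" unfolding J_def by blast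
  ultimately show ?thesis using sub_has_factors_iff[OF S] by blast
qed

lemma sub_has_factors_unique:
  "S \<in> subobjects C X \<Longrightarrow> s_set C X I F J \<Longrightarrow> s_set C X I F K
    \<Longrightarrow> sub_has_factors C S F J \<Longrightarrow> sub_has_factors C S F K \<Longrightarrow> J = K"
  using sub_has_factors_iff cl_image_inj unfolding s_set_def by metis

end

theorem proposition3p8:
  fixes C :: "('o, 'm) add_cat" and X :: 'o and I :: "'i set" and F :: "'i \<Rightarrow> 'o"
  assumes "finite_length_abelian_category C"
    and "X \<in> Obj C"
    and "nonisomorphic_simple_factors C X I F"
  shows "(\<forall>J. s_set C X I F J \<longrightarrow> (\<exists>!S. S \<in> subobjects C X \<and> sub_has_factors C S F J)) \<and>
    bij_betw (\<lambda>J. THE S. S \<in> subobjects C X \<and> sub_has_factors C S F J)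
      {J. s_set C X I F J} (subobjects C X)"
proof -
  interpret abelian_category C
    using assms(1) by (simp add: finite_length_abelian_category_def)
  interpret multiplicity_free_object C X I F
    using assms(2,3) by unfold_locales
  let ?sub = "\<lambda>J. THE S. S \<in> subobjects C X \<and> sub_has_factors C S F J"
  have ex1: "\<exists>!S. S \<in> subobjects C X \<and> sub_has_factors C S F J" if "s_set C X I F J" for J
    using ex1_subobject_of_s_set[OF that] .
  have sub: "?sub J \<in> subobjects C X \<and> sub_has_factors C (?sub J) F J" if "s_set C X I F J" for J
    using theI'[OF ex1[OF that]] .
  have "bij_betw ?sub {J. s_set C X I F J} (subobjects C X)"
    unfolding bij_betw_def
  proof
    show "inj_on ?sub {J. s_set C X I F J}"
    proof (rule inj_onI)
      fix J K assume "J \<in> {J. s_set C X I F J}" "K \<in> {J. s_set C X I F J}" and eq: "?sub J = ?sub K"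
      then have s: "s_set C X I F J" "s_set C X I F K" by auto
      show "J = K" using sub_has_factors_unique[OF _ s] sub[OF s(1)] sub[OF s(2)] eq by metis
    qed
    show "?sub ` {J. s_set C X I F J} = subobjects C X"
    proof
      show "?sub ` {J. s_set C X I F J} \<subseteq> subobjects C X" using sub by blast
      show "subobjects C X \<subseteq> ?sub ` {J. s_set C X I F J}"
      proof
        fix S assume S: "S \<in> subobjects C X"
        then obtain J where J: "s_set C X I F J" "sub_has_factors C S F J" using s_set_of_subobject by blast
        have "?sub J = S" using the1_equality[OF ex1[OF J(1)]] S J(2) by blast
        then show "S \<in> ?sub ` {J. s_set C X I F J}" using J(1) by blast
      qed
    qed
  qed
  then show ?thesis using ex1 by blast
qed

end
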